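(* For each fixed $d$, the $1$-RP-$d$-SP problem can be solved in $3^n\cdot(n+m)^{\mathcal{O}(1)}$ time, where $n=|U|$ and $m=|\mathcal{S}|$.
   Context: An instance of $1$-RP-$d$-SP consists of a finite universe $U=U_1\cup\dots\cup U_p$ partitioned among $p$ agents, a collection $\mathcal{S}\subseteq 2^U$ of sets each of size at most $d$, and an integer $k$. A set $S$ is $i$-internal if $S\subseteq U_i$. For a collection $\mathcal{X}\subseteq\mathcal{S}$ of pairwise disjoint sets, agent $i$ $1$-rejects $\mathcal{X}$ if there exist $\mathcal{X}_{\mathrm{rej}}\subseteq\mathcal{X}$ with $|\mathcal{X}_{\mathrm{rej}}|\le 1$ and a collection $\mathcal{X}_{\mathrm{int}}\subseteq\mathcal{S}$ of $i$-internal sets such that $(\mathcal{X}\setminus\mathcal{X}_{\mathrm{rej}})\cup\mathcal{X}_{\mathrm{int}}$ consists of pairwise disjoint sets and covers more elements of $U_i$ than $\mathcal{X}$ does. $\mathcal{X}$ is $1$-rejection-proof if no agent $1$-rejects it. The problem asks whether there is a $1$-rejection-proof collection of pairwise disjoint sets of $\mathcal{S}$ covering at least $k$ elements of $U$. *)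

theory Defs
  imports Main "HOL-Library.Disjoint_Sets"
begin

section \<open>The problem\<close>

text \<open>An instance over elements of type \<open>'a\<close>; the agents are \<open>1, \<dots>, agents I\<close>, and agent \<open>i\<close> owns
  \<open>part I i\<close>.\<close>

record 'a rp_instance =
  agents :: nat
  part :: "nat \<Rightarrow> 'a set"
  sets :: "'a set set"
  target :: int

definition universe :: "'a rp_instance \<Rightarrow> 'a set" where
  "universe I = (\<Union>i\<in>{1..agents I}. part I i)"

definition rp_sp_instance :: "nat \<Rightarrow> 'a rp_instance \<Rightarrow> bool" where
  "rp_sp_instance d I \<longleftrightarrow>
     finite (universe I) \<and> disjoint_family_on (part I) {1..agents I} \<and>
     sets I \<subseteq> Pow (universe I) \<and> (\<forall>S\<in>sets I. card S \<le> d)"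

definition internal :: "'a rp_instance \<Rightarrow> nat \<Rightarrow> 'a set \<Rightarrow> bool" where
  "internal I i S \<longleftrightarrow> S \<subseteq> part I i"

definition one_rejects :: "'a rp_instance \<Rightarrow> nat \<Rightarrow> 'a set set \<Rightarrow> bool" where
  "one_rejects I i X \<longleftrightarrow>
     (\<exists>Xrej Xint. Xrej \<subseteq> X \<and> card Xrej \<le> 1 \<and>
        Xint \<subseteq> sets I \<and> (\<forall>S\<in>Xint. internal I i S) \<and>
        disjoint ((X - Xrej) \<union> Xint) \<and>
        card (\<Union>((X - Xrej) \<union> Xint) \<inter> part I i) > card (\<Union>X \<inter> part I i))"

definition one_rejection_proof :: "'a rp_instance \<Rightarrow> 'a set set \<Rightarrow> bool" where
  "one_rejection_proof I X \<longleftrightarrow> (\<forall>i\<in>{1..agents I}. \<not> one_rejects I i X)"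

definition yes_instance :: "'a rp_instance \<Rightarrow> bool" where
  "yes_instance I \<longleftrightarrow>
     (\<exists>X. X \<subseteq> sets I \<and> disjoint X \<and> one_rejection_proof I X \<and> int (card (\<Union>X)) \<ge> target I)"


section \<open>The machine model\<close>

text \<open>Structured programs for a random access machine with numbered registers and numbered arrays of
  unbounded length (a program mentions only finitely many of each), every cell holding a natural
  number. The only arithmetic is \<open>+1\<close> and \<open>-1\<close> (successor RAM), and every instruction
  and every test takes one unit of time. Since values grow by at most one per time unit
  (lemma \<open>exec_values_bounded\<close> below), unit cost is not a source of hidden computational power: the
  logarithmic cost of a run is larger only by a factor that is logarithmic in the running time
  and in the largest input number. There is no unit-cost addition or multiplication.\<close>

datatype test = Less nat nat | Equal nat nat

datatype com =
    Const nat nat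
  | Copy nat nat
  | Inc nat
  | Dec nat
  | Load nat nat nat
  | Store nat nat nat
  | Seq com com
  | Cond test com com
  | While test com

type_synonym state = "(nat \<Rightarrow> nat) \<times> (nat \<Rightarrow> nat \<Rightarrow> nat)"

fun holds :: "test \<Rightarrow> state \<Rightarrow> bool" where
  "holds (Less x y) (r, m) \<longleftrightarrow> r x < r y"
| "holds (Equal x y) (r, m) \<longleftrightarrow> r x = r y"

text \<open>\<open>exec c s t s'\<close>: started in \<open>s\<close>, program \<open>c\<close> halts in \<open>s'\<close> after exactly \<open>t\<close> time units.
  \<open>Load x a y\<close> sets register \<open>x\<close> to cell number \<open>r y\<close> of array \<open>a\<close>; \<open>Store a x y\<close> writes
  register \<open>y\<close> to cell number \<open>r x\<close> of array \<open>a\<close>.\<close>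

inductive exec :: "com \<Rightarrow> state \<Rightarrow> nat \<Rightarrow> state \<Rightarrow> bool" where
  Const: "exec (Const x v) (r, m) 1 (r(x := v), m)"
| Copy: "exec (Copy x y) (r, m) 1 (r(x := r y), m)"
| Inc: "exec (Inc x) (r, m) 1 (r(x := r x + 1), m)"
| Dec: "exec (Dec x) (r, m) 1 (r(x := r x - 1), m)"
| Load: "exec (Load x a y) (r, m) 1 (r(x := m a (r y)), m)"
| Store: "exec (Store a x y) (r, m) 1 (r, m(a := (m a)(r x := r y)))"
| Seq: "exec c1 s t1 s' \<Longrightarrow> exec c2 s' t2 s'' \<Longrightarrow> exec (Seq c1 c2) s (t1 + t2) s''"
| CondTrue: "holds b s \<Longrightarrow> exec c1 s t s' \<Longrightarrow> exec (Cond b c1 c2) s (t + 1) s'"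
| CondFalse: "\<not> holds b s \<Longrightarrow> exec c2 s t s' \<Longrightarrow> exec (Cond b c1 c2) s (t + 1) s'"
| WhileFalse: "\<not> holds b s \<Longrightarrow> exec (While b c) s 1 s"
| WhileTrue: "holds b s \<Longrightarrow> exec c s t1 s' \<Longrightarrow> exec (While b c) s' t2 s'' \<Longrightarrow>
    exec (While b c) s (1 + t1 + t2) s''"

inductive_cases exec_atomE:
  "exec (Const x v) s t s'" "exec (Copy x y) s t s'" "exec (Inc x) s t s'" "exec (Dec x) s t s'"
  "exec (Load x a y) s t s'" "exec (Store a x y) s t s'"

inductive_cases exec_SeqE: "exec (Seq c1 c2) s t s'"
inductive_cases exec_CondE: "exec (Cond b c1 c2) s t s'"
inductive_cases exec_WhileE: "exec (While b c) s t s'"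

lemma exec_deterministic:
  "exec c s t s' \<Longrightarrow> exec c s u s'' \<Longrightarrow> t = u \<and> s' = s''"
proof (induction arbitrary: u s'' rule: exec.induct)
  case (Seq c1 s t1 s1 c2 t2 s2)
  from Seq.prems show ?case by (rule exec_SeqE) (metis Seq.IH)
next
  case (CondTrue b s c1 t s1 c2)
  from CondTrue.prems show ?case by (rule exec_CondE) (metis add_Suc Suc_eq_plus1 plus_1_eq_Suc CondTrue.hyps(1) CondTrue.IH)+
next
  case (CondFalse b s c2 t s1 c1)
  from CondFalse.prems show ?case by (rule exec_CondE) (metis add_Suc Suc_eq_plus1 plus_1_eq_Suc CondFalse.hyps(1) CondFalse.IH)+
next
  case (WhileFalse b s c)
  from WhileFalse.prems show ?case by (rule exec_WhileE) (simp_all add: WhileFalse.hyps)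
next
  case (WhileTrue b s c t1 s1 t2 s2)
  from WhileTrue.prems show ?case by (rule exec_WhileE) (metis add_Suc Suc_eq_plus1 plus_1_eq_Suc WhileTrue.hyps(1) WhileTrue.IH)+
qed (erule exec_atomE, simp)+

fun consts_le :: "nat \<Rightarrow> com \<Rightarrow> bool" where
  "consts_le B (Const x v) \<longleftrightarrow> v \<le> B"
| "consts_le B (Seq c1 c2) \<longleftrightarrow> consts_le B c1 \<and> consts_le B c2"
| "consts_le B (Cond b c1 c2) \<longleftrightarrow> consts_le B c1 \<and> consts_le B c2"
| "consts_le B (While b c) \<longleftrightarrow> consts_le B c"
| "consts_le B _ \<longleftrightarrow> True"

definition values_le :: "nat \<Rightarrow> state \<Rightarrow> bool" where
  "values_le B s \<longleftrightarrow> (\<forall>x. fst s x \<le> B) \<and> (\<forall>a j. snd s a j \<le> B)"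

lemma values_le_mono: "values_le B s \<Longrightarrow> B \<le> B' \<Longrightarrow> values_le B' s"
  unfolding values_le_def by (meson le_trans)

lemma consts_le_mono: "consts_le B c \<Longrightarrow> B \<le> B' \<Longrightarrow> consts_le B' c"
  by (induction B c rule: consts_le.induct) auto

lemma exec_values_bounded:
  "exec c s t s' \<Longrightarrow> consts_le B c \<Longrightarrow> values_le B s \<Longrightarrow> values_le (B + t) s'"
proof (induction arbitrary: B rule: exec.induct)
  case (Seq c1 s t1 s' c2 t2 s'')
  have "values_le (B + t1) s'" using Seq by simp
  moreover have "consts_le (B + t1) c2" using Seq.prems by (auto intro: consts_le_mono)
  ultimately have "values_le (B + t1 + t2) s''" by (rule Seq.IH(2)[rotated])
  then show ?case by (simp add: add.assoc)
next
  case (WhileTrue b s c t1 s' t2 s'')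
  have "values_le (B + t1) s'" using WhileTrue by simp
  moreover have "consts_le (B + t1) (While b c)"
    using WhileTrue.prems(1) by (rule consts_le_mono) simp
  ultimately have "values_le (B + t1 + t2) s''" by (rule WhileTrue.IH(2)[rotated])
  then show ?case by (rule values_le_mono) simp
next
  case (CondTrue b s c1 t s' c2)
  then have "values_le (B + t) s'" by simp
  then show ?case by (rule values_le_mono) simp
next
  case (CondFalse b s c2 t s' c1)
  then have "values_le (B + t) s'" by simp
  then show ?case by (rule values_le_mono) simp
next
  case (WhileFalse b s c)
  from WhileFalse.prems(2) show ?case by (rule values_le_mono) simp
next
  case (Dec x r m)
  have "r x \<le> B" using Dec.prems(2) by (simp add: values_le_def)
  then have "r x - 1 \<le> B + 1" by linarith
  then show ?case using Dec.prems(2) by (simp add: values_le_def le_SucI)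
qed (simp_all add: values_le_def le_SucI)

text \<open>The input word is the contents of array \<open>0\<close>; all other cells and all registers are \<open>0\<close>. The
  answer is read off register \<open>0\<close>.\<close>

definition init :: "nat list \<Rightarrow> state" where
  "init w = ((\<lambda>x. 0), (\<lambda>a j. if a = 0 \<and> j < length w then w ! j else 0))"

definition answers_within :: "com \<Rightarrow> nat list \<Rightarrow> bool \<Rightarrow> nat \<Rightarrow> bool" where
  "answers_within P w b T \<longleftrightarrow>
     (\<exists>t s'. exec P (init w) t s' \<and> t \<le> T \<and> fst s' 0 = (if b then 1 else 0))"


section \<open>Encoding of instances\<close>

text \<open>An instance is presented by an enumeration of its universe and an enumeration of its sets (both
  without repetition, in arbitrary order): a header with \<open>n\<close>, \<open>m\<close>, the number of agents and the
  sign and absolute value of the target, then the owner of each element, then the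
  \<open>m \<times> n\<close> incidence matrix of the set system, row by row.\<close>

definition owner :: "'a rp_instance \<Rightarrow> 'a \<Rightarrow> nat" where
  "owner I u = (THE i. i \<in> {1..agents I} \<and> u \<in> part I i)"

definition enumerates :: "'a list \<Rightarrow> 'a set \<Rightarrow> bool" where
  "enumerates xs A \<longleftrightarrow> distinct xs \<and> set xs = A"

definition encode :: "'a rp_instance \<Rightarrow> 'a list \<Rightarrow> 'a set list \<Rightarrow> nat list" where
  "encode I us Ss =
     [length us, length Ss, agents I, (if target I < 0 then 1 else 0), nat \<bar>target I\<bar>]
     @ map (owner I) us
     @ concat (map (\<lambda>S. map (\<lambda>u. if u \<in> S then 1 else 0) us) Ss)"

end

theory Submission
  imports Defs
begin

text \<open>Let a packing \<open>X\<close> cover exactly \<open>W\<close>. If agent \<open>i\<close> rejects \<open>S \<in> X\<close>, then the elements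
  available to its internal sets are those of \<open>U\<^sub>i\<close> in \<open>S\<close> or outside \<open>W\<close>, so the rejection pays off iff
  the best internal packing of this region covers more than \<open>|S \<inter> U\<^sub>i|\<close> elements. This depends on \<open>S\<close> and
  \<open>W\<close> only: \<open>X\<close> is 1-rejection-proof iff each of its sets is stable for \<open>W\<close>, and one has to decide
  whether some large \<open>W\<close> can be partitioned into sets stable for \<open>W\<close>.

  Pairs \<open>Y \<subseteq> W \<subseteq> U\<close> are ternary vectors (digit 0: outside \<open>W\<close>, 1: in \<open>W - Y\<close>, 2: in \<open>Y\<close>), of which there
  are \<open>3\<^sup>n\<close>. Removing a set from \<open>Y\<close> turns digits 2 into 1 and thus decreases the base-3 value, so one pass
  in numerical order fills the table of all \<open>(W, Y)\<close> such that \<open>Y\<close> is partitioned by sets stable for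
  \<open>W\<close>. A pass of the same shape fills beforehand the table of best packings of \<open>Y\<close> by sets
  with a single owner, which decides stability.\<close>

subsection \<open>Timed total correctness\<close>

text \<open>The two passes cannot be merged in this layout: the region of an agent contains elements
  outside \<open>W\<close>, so the index of its best packing need not lie below the index of the
  pair under consideration. The table of best packings must therefore be complete before the first
  stability test. One such table serves all agents, because a set with a single owner that lies in a
  region of agent \<open>i\<close> is \<open>i\<close>-internal, whoever \<open>i\<close> is. The
  number of agents is not bounded by any polynomial in \<open>n + m\<close>, since parts may be
  empty. So no program loops over agents; they are reached as owners of elements. An empty set would
  leave the base-3 value unchanged and refer to the entry being computed. Both recursions skip empty
  sets, which cover nothing anyway. The cubic factor of the time bound comes from the second pass:
  for each vector there are \<open>m\<close> sets, for each of these up to \<open>n\<close> owners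
  to test, and each test builds a region and evaluates its index in time linear in
  \<open>n\<close>.\<close>

type_synonym regs = "nat \<Rightarrow> nat"
type_synonym arrs = "nat \<Rightarrow> nat \<Rightarrow> nat"

text \<open>\<open>T\<close> is an upper bound, so costs may be rounded up; the existential speaks
  about the only run there is, since \<open>exec\<close> is deterministic.\<close>

definition runs :: "com \<Rightarrow> regs \<Rightarrow> arrs \<Rightarrow> nat \<Rightarrow> (regs \<Rightarrow> arrs \<Rightarrow> bool) \<Rightarrow> bool" where
  "runs c r m T Q \<longleftrightarrow> (\<exists>t r' m'. exec c (r, m) t (r', m') \<and> t \<le> T \<and> Q r' m')"

fun wregs :: "com \<Rightarrow> nat set" where
  "wregs (Const x v) = {x}"
| "wregs (Copy x y) = {x}"
| "wregs (Inc x) = {x}"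
| "wregs (Dec x) = {x}"
| "wregs (Load x a y) = {x}"
| "wregs (Store a x y) = {}"
| "wregs (Seq c1 c2) = wregs c1 \<union> wregs c2"
| "wregs (Cond b c1 c2) = wregs c1 \<union> wregs c2"
| "wregs (While b c) = wregs c"

fun warrs :: "com \<Rightarrow> nat set" where
  "warrs (Store a x y) = {a}"
| "warrs (Seq c1 c2) = warrs c1 \<union> warrs c2"
| "warrs (Cond b c1 c2) = warrs c1 \<union> warrs c2"
| "warrs (While b c) = warrs c"
| "warrs _ = {}"

text \<open>The frame condition is a syntactic consequence of \<open>exec\<close>, so specifications only mention
  what a program computes and \<open>runs_mono\<close>, \<open>runs_Seq\<close> and \<open>runs_For\<close> supply what it preserves.\<close>

definition frame :: "com \<Rightarrow> regs \<Rightarrow> arrs \<Rightarrow> regs \<Rightarrow> arrs \<Rightarrow> bool" where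
  "frame c r m r' m' \<longleftrightarrow> (\<forall>x. x \<notin> wregs c \<longrightarrow> r' x = r x) \<and> (\<forall>a. a \<notin> warrs c \<longrightarrow> m' a = m a)"

lemma exec_frame:
  "exec c s t s' \<Longrightarrow> (\<forall>x. x \<notin> wregs c \<longrightarrow> fst s' x = fst s x) \<and> (\<forall>a. a \<notin> warrs c \<longrightarrow> snd s' a = snd s a)"
  by (induction rule: exec.induct) auto

lemma runs_mono:
  "runs c r m T Q \<Longrightarrow> T \<le> T' \<Longrightarrow> (\<And>r' m'. Q r' m' \<Longrightarrow> frame c r m r' m' \<Longrightarrow> Q' r' m') \<Longrightarrow> runs c r m T' Q'"
  unfolding runs_def frame_def using exec_frame[of c "(r, m)"] by fastforce

lemma runs_le: "runs c r m T Q \<Longrightarrow> T \<le> T' \<Longrightarrow> runs c r m T' Q"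
  by (rule runs_mono)

section \<open>Symbolic execution of straight-line code by rewriting\<close>

lemma exec_simps:
  "exec (Const x v) (r, m) t s' \<longleftrightarrow> t = 1 \<and> s' = (r(x := v), m)"
  "exec (Copy x y) (r, m) t s' \<longleftrightarrow> t = 1 \<and> s' = (r(x := r y), m)"
  "exec (Inc x) (r, m) t s' \<longleftrightarrow> t = 1 \<and> s' = (r(x := r x + 1), m)"
  "exec (Dec x) (r, m) t s' \<longleftrightarrow> t = 1 \<and> s' = (r(x := r x - 1), m)"
  "exec (Load x a y) (r, m) t s' \<longleftrightarrow> t = 1 \<and> s' = (r(x := m a (r y)), m)"
  "exec (Store a x y) (r, m) t s' \<longleftrightarrow> t = 1 \<and> s' = (r, m(a := (m a)(r x := r y)))"
  by (auto intro: exec.intros[unfolded One_nat_def add_Suc_right add_0_right] elim!: exec_atomE)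

lemma runs_atom [simp]:
  "runs (Const x v) r m T Q \<longleftrightarrow> 0 < T \<and> Q (r(x := v)) m"
  "runs (Copy x y) r m T Q \<longleftrightarrow> 0 < T \<and> Q (r(x := r y)) m"
  "runs (Inc x) r m T Q \<longleftrightarrow> 0 < T \<and> Q (r(x := Suc (r x))) m"
  "runs (Dec x) r m T Q \<longleftrightarrow> 0 < T \<and> Q (r(x := r x - 1)) m"
  "runs (Load x a y) r m T Q \<longleftrightarrow> 0 < T \<and> Q (r(x := m a (r y))) m"
  "runs (Store a x y) r m T Q \<longleftrightarrow> 0 < T \<and> Q r (m(a := (m a)(r x := r y)))"
  by (auto simp: runs_def exec_simps)

lemma exec_Seq_iff:
  "exec (Seq c1 c2) s t s'' \<longleftrightarrow> (\<exists>t1 t2 s'. t = t1 + t2 \<and> exec c1 s t1 s' \<and> exec c2 s' t2 s'')"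
  by (rule iffI, erule exec_SeqE, blast) (blast intro: exec.Seq)

lemma exec_Cond_iff:
  "exec (Cond b c1 c2) s t s' \<longleftrightarrow> (\<exists>t'. t = Suc t' \<and> exec (if holds b s then c1 else c2) s t' s')"
  using exec.CondTrue[of b s c1 _ s' c2] exec.CondFalse[of b s c2 _ s' c1]
  by (auto elim!: exec_CondE)

lemma runs_Seq_time:
  "runs c1 r m T1 (\<lambda>r' m'. runs c2 r' m' T2 Q) \<Longrightarrow> runs (Seq c1 c2) r m (T1 + T2) Q"
  unfolding runs_def by (meson exec.Seq add_mono)

lemma runs_Suc:
  assumes "\<And>t s'. exec c (r, m) t s' \<longleftrightarrow> (\<exists>t'. t = Suc t' \<and> exec c' (r', m') t' s')"
  shows "runs c r m T Q \<longleftrightarrow> 0 < T \<and> runs c' r' m' (T - 1) Q"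
proof -
  have "Suc t \<le> T \<longleftrightarrow> 0 < T \<and> t \<le> T - 1" for t by auto
  then show ?thesis unfolding runs_def assms by blast
qed

lemma runs_Seq_atom:
  assumes "\<And>t s'. exec c1 (r, m) t s' \<longleftrightarrow> t = 1 \<and> s' = (r1, m1)"
  shows "runs (Seq c1 c2) r m T Q \<longleftrightarrow> 0 < T \<and> runs c2 r1 m1 (T - 1) Q"
proof -
  have "exec (Seq c1 c2) (r, m) t s' \<longleftrightarrow> (\<exists>t'. t = Suc t' \<and> exec c2 (r1, m1) t' s')" for t s'
    by (auto simp: exec_Seq_iff assms)
  then show ?thesis by (rule runs_Suc)
qed

text \<open>Each rewrite step executes the first instruction and counts the budget down. The
  conjunct \<open>0 < T\<close> keeps the truncated subtraction \<open>T - 1\<close>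
  faithful.\<close>

lemma runs_Seq_simps [simp]:
  "runs (Seq (Const x v) c) r m T Q \<longleftrightarrow> 0 < T \<and> runs c (r(x := v)) m (T - 1) Q"
  "runs (Seq (Copy x y) c) r m T Q \<longleftrightarrow> 0 < T \<and> runs c (r(x := r y)) m (T - 1) Q"
  "runs (Seq (Inc x) c) r m T Q \<longleftrightarrow> 0 < T \<and> runs c (r(x := Suc (r x))) m (T - 1) Q"
  "runs (Seq (Dec x) c) r m T Q \<longleftrightarrow> 0 < T \<and> runs c (r(x := r x - 1)) m (T - 1) Q"
  "runs (Seq (Load x a y) c) r m T Q \<longleftrightarrow> 0 < T \<and> runs c (r(x := m a (r y))) m (T - 1) Q"
  "runs (Seq (Store a x y) c) r m T Q \<longleftrightarrow> 0 < T \<and> runs c r (m(a := (m a)(r x := r y))) (T - 1) Q"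
  by (rule runs_Seq_atom; simp add: exec_simps)+

lemma runs_Cond [simp]:
  "runs (Cond b c1 c2) r m T Q \<longleftrightarrow> 0 < T \<and> runs (if holds b (r, m) then c1 else c2) r m (T - 1) Q"
  by (rule runs_Suc) (rule exec_Cond_iff)

text \<open>The continuation moves into the branch that is taken, so no assertion has to be stated
  for the join after the conditional.\<close>

lemma runs_Seq_Cond [simp]:
  "runs (Seq (Cond b c1 c2) c) r m T Q \<longleftrightarrow>
     0 < T \<and> runs (if holds b (r, m) then Seq c1 c else Seq c2 c) r m (T - 1) Q"
proof -
  have "exec (Seq (Cond b c1 c2) c) (r, m) t s' \<longleftrightarrow>
      (\<exists>t'. t = Suc t' \<and> exec (if holds b (r, m) then Seq c1 c else Seq c2 c) (r, m) t' s')" for t s'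
  proof
    assume "exec (Seq (Cond b c1 c2) c) (r, m) t s'"
    then obtain t1 t2 s1 where "t = Suc t1 + t2" "exec (if holds b (r, m) then c1 else c2) (r, m) t1 s1"
      "exec c s1 t2 s'" unfolding exec_Seq_iff exec_Cond_iff by blast
    then show "\<exists>t'. t = Suc t' \<and> exec (if holds b (r, m) then Seq c1 c else Seq c2 c) (r, m) t' s'"
      by (intro exI[of _ "t1 + t2"]) (simp add: exec.Seq split: if_splits)
  next
    assume "\<exists>t'. t = Suc t' \<and> exec (if holds b (r, m) then Seq c1 c else Seq c2 c) (r, m) t' s'"
    then obtain t' where t: "t = Suc t'" "exec (Seq (if holds b (r, m) then c1 else c2) c) (r, m) t' s'"
      by (auto split: if_splits)
    then obtain t1 t2 s1 where "t = Suc t1 + t2" "exec (if holds b (r, m) then c1 else c2) (r, m) t1 s1"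
      "exec c s1 t2 s'" unfolding exec_Seq_iff by auto
    then show "exec (Seq (Cond b c1 c2) c) (r, m) t s'"
      unfolding exec_Seq_iff exec_Cond_iff by blast
  qed
  then show ?thesis by (rule runs_Suc)
qed

text \<open>Nesting to the right exposes the first instruction, also after a branch of a conditional
  has been put in front of its continuation.\<close>

lemma runs_Seq_Seq [simp]: "runs (Seq (Seq c1 c2) c3) r m T Q \<longleftrightarrow> runs (Seq c1 (Seq c2 c3)) r m T Q"
proof -
  have "exec (Seq (Seq c1 c2) c3) s t s' \<longleftrightarrow> exec (Seq c1 (Seq c2 c3)) s t s'" for s t s'
  proof
    assume "exec (Seq (Seq c1 c2) c3) s t s'"
    then obtain t1 t2 t3 s1 s2 where
      "t = t1 + t2 + t3" "exec c1 s t1 s1" "exec c2 s1 t2 s2" "exec c3 s2 t3 s'"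
      unfolding exec_Seq_iff by blast
    then show "exec (Seq c1 (Seq c2 c3)) s t s'"
      using exec.Seq[of c1 s t1 s1 "Seq c2 c3" "t2 + t3" s'] exec.Seq by (simp add: add.assoc)
  next
    assume "exec (Seq c1 (Seq c2 c3)) s t s'"
    then obtain t1 t2 t3 s1 s2 where
      "t = t1 + (t2 + t3)" "exec c1 s t1 s1" "exec c2 s1 t2 s2" "exec c3 s2 t3 s'"
      unfolding exec_Seq_iff by blast
    then show "exec (Seq (Seq c1 c2) c3) s t s'"
      using exec.Seq[of "Seq c1 c2" s "t1 + t2" s2 c3 t3 s'] exec.Seq by (simp add: add.assoc)
  qed
  then show ?thesis by (simp add: runs_def)
qed

section \<open>Composition and loops with stated assertions\<close>

lemma runs_Seq:
  assumes "runs c1 r m T1 Q1" "T1 \<le> T"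
    and "\<And>r' m'. Q1 r' m' \<Longrightarrow> frame c1 r m r' m' \<Longrightarrow> runs c2 r' m' (T - T1) Q"
  shows "runs (Seq c1 c2) r m T Q"
proof -
  have "runs c1 r m T1 (\<lambda>r' m'. runs c2 r' m' (T - T1) Q)"
    using assms(1) by (rule runs_mono) (use assms(3) in auto)
  from runs_Seq_time[OF this] show ?thesis using assms(2) by simp
qed

text \<open>\<open>k\<close> counts the finished iterations out of a number \<open>N\<close> known
  beforehand. Every iteration pays one unit for its test, and the final unit is the failing test.
  The start at an arbitrary \<open>k\<close> is what the induction downwards from \<open>N\<close>
  needs.\<close>

lemma runs_While:
  assumes "\<And>k r m. k < N \<Longrightarrow> I k r m \<Longrightarrow> holds b (r, m) \<and> runs c r m T (I (Suc k))"
    and "\<And>r m. I N r m \<Longrightarrow> \<not> holds b (r, m)"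
    and "I k r m" "k \<le> N"
  shows "runs (While b c) r m ((N - k) * (T + 1) + 1) (I N)"
  using assms(4,3)
proof (induction k arbitrary: r m rule: inc_induct)
  case base
  then have "exec (While b c) (r, m) 1 (r, m)" using assms(2) by (intro exec.WhileFalse) auto
  then show ?case unfolding runs_def using base by auto
next
  case (step k)
  then obtain t1 r1 m1 where 1: "exec c (r, m) t1 (r1, m1)" "t1 \<le> T" "I (Suc k) r1 m1"
    and h: "holds b (r, m)" using assms(1) unfolding runs_def by metis
  from step.IH[OF 1(3)] obtain t2 r2 m2
    where 2: "exec (While b c) (r1, m1) t2 (r2, m2)" "t2 \<le> (N - Suc k) * (T + 1) + 1" "I N r2 m2"
    unfolding runs_def by metis
  have "N - k = Suc (N - Suc k)" using step.hyps by simp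
  then have "1 + t1 + t2 \<le> (N - k) * (T + 1) + 1" using 1(2) 2(2) by simp
  then show ?case unfolding runs_def using exec.WhileTrue[OF h 1(1) 2(1)] 2(3) by blast
qed

definition For :: "nat \<Rightarrow> nat \<Rightarrow> com \<Rightarrow> com" where
  "For v n c = Seq (Const v 0) (While (Less v n) (Seq c (Inc v)))"

lemma writes_For [simp]: "wregs (For v n c) = insert v (wregs c)" "warrs (For v n c) = warrs c"
  by (auto simp: For_def)

text \<open>The loop costs at most \<open>r n * (T + 2) + 2\<close>. The strict bound
  \<open>r n < L\<close> leaves one spare round, which pays for the initialisation and the failing
  test and gives the handy product \<open>(T + 2) * L\<close>.\<close>

lemma runs_For:
  assumes n: "r n < L" "n \<noteq> v" "n \<notin> wregs c" "v \<notin> wregs c"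
    and I0: "I 0 (r(v := 0)) m"
    and step: "\<And>k r' m'. k < r n \<Longrightarrow> r' v = k \<Longrightarrow> I k r' m' \<Longrightarrow> frame (For v n c) r m r' m' \<Longrightarrow>
      runs c r' m' T (\<lambda>r'' m''. I (Suc k) (r''(v := Suc k)) m'')"
  shows "runs (For v n c) r m ((T + 2) * L) (I (r n))"
proof -
  \<comment> \<open>The frame condition belongs to the invariant because it keeps the bound in
    register \<open>n\<close> fixed while the loop runs.\<close>
  let ?J = "\<lambda>k r' m'. I k r' m' \<and> r' v = k \<and> frame (For v n c) r m r' m'"
  have "runs (While (Less v n) (Seq c (Inc v))) (r(v := 0)) m ((r n - 0) * (T + 1 + 1) + 1) (?J (r n))"
  proof (rule runs_While)
    fix k r' m' assume k: "k < r n" and J: "?J k r' m'"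
    have rn: "r' n = r n" using J n by (auto simp: frame_def)
    have "runs c r' m' T (\<lambda>r'' m''. I (Suc k) (r''(v := Suc k)) m'')" using step k J by blast
    then have "runs (Seq c (Inc v)) r' m' (T + 1) (?J (Suc k))"
      by (rule runs_Seq) (use J n in \<open>auto simp: frame_def\<close>)
    then show "holds (Less v n) (r', m') \<and> runs (Seq c (Inc v)) r' m' (T + 1) (?J (Suc k))"
      using k J rn by simp
  next
    fix r' m' assume J: "?J (r n) r' m'"
    have "r' n = r n" using J n by (auto simp: frame_def)
    then show "\<not> holds (Less v n) (r', m')" using J by simp
  next
    show "?J 0 (r(v := 0)) m" using I0 unfolding frame_def by simp
  qed simp
  then have "runs (While (Less v n) (Seq c (Inc v))) (r(v := 0)) m (r n * (T + 2) + 1) (I (r n))"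
    by (rule runs_mono) auto
  then have *: "runs (For v n c) r m (r n * (T + 2) + 2) (I (r n))"
    by (simp add: For_def)
  obtain L' where "L = Suc L'" "r n \<le> L'" using n(1) by (cases L) auto
  then have "r n * (T + 2) + 2 \<le> (T + 2) * L"
    using mult_le_mono1[of "r n" L' "T + 2"] by (simp add: algebra_simps)
  then show ?thesis using runs_mono[OF *] by simp
qed

subsection \<open>Packings\<close>

definition packs :: "'a set set \<Rightarrow> 'a set \<Rightarrow> 'a set set \<Rightarrow> bool" where
  "packs F V Z \<longleftrightarrow> Z \<subseteq> F \<and> disjoint Z \<and> \<Union>Z \<subseteq> V"

text \<open>The empty packing makes the set of values nonempty, and a finite \<open>V\<close> makes
  it finite, so for finite \<open>V\<close> this is a genuine maximum.\<close>

definition max_cover :: "'a set set \<Rightarrow> 'a set \<Rightarrow> nat" where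
  "max_cover F V = Max {card (\<Union>Z) | Z. packs F V Z}"

definition exact :: "'a set set \<Rightarrow> 'a set \<Rightarrow> bool" where
  "exact F Y \<longleftrightarrow> (\<exists>Z\<subseteq>F. disjoint Z \<and> \<Union>Z = Y)"

lemma packs_empty [simp]: "packs F V {}"
  by (simp add: packs_def)

lemma packs_insert:
  assumes "packs F (V - S) Z" "S \<in> F" "S \<subseteq> V"
  shows "packs F V (insert S Z)"
  using assms by (auto simp: packs_def disjoint_def)

lemma packs_remove:
  assumes "packs F V Z" "S \<in> Z"
  shows "packs F (V - S) (Z - {S})" "\<Union>(Z - {S}) = \<Union>Z - S"
  using assms by (auto simp: packs_def disjoint_def)

text \<open>Thresholds \<open>k\<close> turn the maximum into an existential statement, the form in
  which candidate sets can be scanned one by one.\<close>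

lemma le_max_cover_iff:
  assumes "finite V"
  shows "k \<le> max_cover F V \<longleftrightarrow> (\<exists>Z. packs F V Z \<and> k \<le> card (\<Union>Z))"
proof -
  let ?A = "{card (\<Union>Z) | Z. packs F V Z}"
  have "?A \<subseteq> {..card V}"
    using card_mono[OF assms] by (auto simp: packs_def)
  then have "finite ?A" by (rule finite_subset) simp
  moreover have "?A \<noteq> {}" using packs_empty by blast
  ultimately show ?thesis unfolding max_cover_def by (subst Max_ge_iff) auto
qed

text \<open>A packing that covers at least one element has a nonempty member. Splitting it off
  leaves a packing of the rest, and sizes add up by disjointness. Asking for
  \<open>S \<noteq> {}\<close> makes this a recursion towards smaller sets.\<close>

lemma max_cover_step:
  assumes "finite V"
  shows "k \<le> max_cover F V \<longleftrightarrow>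
    k = 0 \<or> (\<exists>S\<in>F. S \<noteq> {} \<and> S \<subseteq> V \<and> k \<le> card S + max_cover F (V - S))"
    (is "_ \<longleftrightarrow> ?R")
proof
  assume "k \<le> max_cover F V"
  then obtain Z where Z: "packs F V Z" "k \<le> card (\<Union>Z)" using le_max_cover_iff[OF assms] by blast
  show ?R
  proof (cases "k = 0")
    case False
    then have "card (\<Union>Z) \<noteq> 0" using Z(2) by linarith
    then have "\<Union>Z \<noteq> {}" by (intro notI) simp
    then obtain S where S: "S \<in> Z" "S \<noteq> {}" by blast
    have fin: "finite (\<Union>Z)" using Z(1) assms finite_subset by (auto simp: packs_def)
    have "card (\<Union>(Z - {S})) \<le> max_cover F (V - S)"
      using le_max_cover_iff[of "V - S"] packs_remove(1)[OF Z(1) S(1)] assms by blast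
    moreover have "card (\<Union>Z) = card S + card (\<Union>(Z - {S}))"
    proof -
      have "card (\<Union>Z) = card (S \<union> \<Union>(Z - {S}))" using S by (intro arg_cong[of _ _ card]) auto
      also have "\<dots> = card S + card (\<Union>(Z - {S}))"
        by (rule card_Un_disjoint)
          (use fin S finite_subset[of S "\<Union>Z"] packs_remove(2)[OF Z(1) S(1)] in auto)
      finally show ?thesis .
    qed
    moreover have "S \<in> F" "S \<subseteq> V" using Z(1) S(1) by (auto simp: packs_def)
    ultimately have "S \<in> F" "S \<noteq> {}" "S \<subseteq> V" "k \<le> card S + max_cover F (V - S)"
      using S(2) Z(2) by auto
    then show ?thesis by blast
  qed simp
next
  assume ?R
  then show "k \<le> max_cover F V"
  proof
    assume "\<exists>S\<in>F. S \<noteq> {} \<and> S \<subseteq> V \<and> k \<le> card S + max_cover F (V - S)"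
    then obtain S where S: "S \<in> F" "S \<subseteq> V" "k \<le> card S + max_cover F (V - S)" by blast
    obtain Z where Z: "packs F (V - S) Z" "max_cover F (V - S) \<le> card (\<Union>Z)"
      using le_max_cover_iff[of "V - S" "max_cover F (V - S)"] assms by blast
    have "card (\<Union>(insert S Z)) = card S + card (\<Union>Z)"
    proof -
      have "finite S" "finite (\<Union>Z)" using S(2) Z(1) assms finite_subset by (auto simp: packs_def)
      then show ?thesis using Z(1) by (subst Union_insert, subst card_Un_disjoint) (auto simp: packs_def)
    qed
    then have "k \<le> card (\<Union>(insert S Z))" using S(3) Z(2) by linarith
    then show ?thesis
      using le_max_cover_iff[OF assms] packs_insert[OF Z(1) S(1,2)] by blast
  qed simp
qed

text \<open>An exact cover of a nonempty set has a nonempty member; by disjointness the other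
  members cover exactly the rest.\<close>

lemma exact_step:
  "exact F Y \<longleftrightarrow> Y = {} \<or> (\<exists>S\<in>F. S \<noteq> {} \<and> S \<subseteq> Y \<and> exact F (Y - S))"
proof -
  have exact: "exact F Y \<longleftrightarrow> (\<exists>Z. packs F Y Z \<and> \<Union>Z = Y)" for Y
    by (auto simp: exact_def packs_def)
  show ?thesis
  proof
    assume "exact F Y"
    then obtain Z where Z: "packs F Y Z" "\<Union>Z = Y" unfolding exact by blast
    show "Y = {} \<or> (\<exists>S\<in>F. S \<noteq> {} \<and> S \<subseteq> Y \<and> exact F (Y - S))"
    proof (cases "Y = {}")
      case False
      then obtain S where S: "S \<in> Z" "S \<noteq> {}" using Z(2) by blast
      have "exact F (Y - S)"
        unfolding exact using packs_remove[OF Z(1) S(1)] Z(2) by blast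
      moreover have "S \<in> F" "S \<subseteq> Y" using Z S by (auto simp: packs_def)
      ultimately show ?thesis using S(2) by blast
    qed simp
  next
    assume "Y = {} \<or> (\<exists>S\<in>F. S \<noteq> {} \<and> S \<subseteq> Y \<and> exact F (Y - S))"
    then show "exact F Y"
    proof
      assume "Y = {}"
      then show ?thesis using exact packs_empty by blast
    next
      assume "\<exists>S\<in>F. S \<noteq> {} \<and> S \<subseteq> Y \<and> exact F (Y - S)"
      then obtain S Z where *: "S \<in> F" "S \<subseteq> Y" "packs F (Y - S) Z" "\<Union>Z = Y - S"
        unfolding exact by blast
      then have "packs F Y (insert S Z)" "\<Union>(insert S Z) = Y" using packs_insert by auto
      then show ?thesis unfolding exact by blast
    qed
  qed
qed


subsection \<open>Rejection depends only on the covered set\<close>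

text \<open>Internality without naming the agent: a set inside a region of agent \<open>i\<close> is
  \<open>i\<close>-internal, so the family of these sets is the same for all agents.\<close>

definition one_owner :: "'a rp_instance \<Rightarrow> 'a set \<Rightarrow> bool" where
  "one_owner I S \<longleftrightarrow> (\<exists>i. \<forall>u\<in>S. owner I u = i)"

definition own_sets :: "'a rp_instance \<Rightarrow> 'a set set" where
  "own_sets I = {S \<in> sets I. one_owner I S}"

definition region :: "'a rp_instance \<Rightarrow> nat \<Rightarrow> 'a set \<Rightarrow> 'a set \<Rightarrow> 'a set" where
  "region I i W S = {v \<in> universe I. owner I v = i \<and> (v \<in> S \<or> v \<notin> W)}"

text \<open>With \<open>S\<close> a set of the packing, \<open>stable\<close> says that nobody gains by rejecting \<open>S\<close>;
  \<open>stable I W {}\<close> covers the case that nothing is rejected. Agents owning no element never gain.\<close>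

definition stable :: "'a rp_instance \<Rightarrow> 'a set \<Rightarrow> 'a set \<Rightarrow> bool" where
  "stable I W S \<longleftrightarrow> (\<forall>u\<in>universe I.
     max_cover (own_sets I) (region I (owner I u) W S) \<le> card {v \<in> S. owner I v = owner I u})"

text \<open>The conjunct \<open>stable I W {}\<close> does not involve \<open>Y\<close>. Carrying it
  along lets the recursion over \<open>Y\<close> check it once, at the base case
  \<open>Y = {}\<close>.\<close>

definition feasible :: "'a rp_instance \<Rightarrow> 'a set \<Rightarrow> 'a set \<Rightarrow> bool" where
  "feasible I W Y \<longleftrightarrow> stable I W {} \<and> exact {S \<in> sets I. stable I W S} Y"

lemma feasible_step:
  "feasible I W Y \<longleftrightarrow> Y = {} \<and> stable I W {} \<or>
    (\<exists>S\<in>sets I. S \<noteq> {} \<and> S \<subseteq> Y \<and> stable I W S \<and> feasible I W (Y - S))"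
  unfolding feasible_def by (subst exact_step) auto

section \<open>From rejection by agents to stability of sets\<close>

context
  fixes I :: "'a rp_instance" and d :: nat
  assumes inst: "rp_sp_instance d I"
begin

lemma finite_universe: "finite (universe I)"
  using inst by (simp add: rp_sp_instance_def)

lemma sets_universe: "S \<in> sets I \<Longrightarrow> S \<subseteq> universe I"
  using inst by (auto simp: rp_sp_instance_def)

text \<open>Disjointness of the parts is what makes the definite description in \<open>owner\<close>
  denote.\<close>

lemma owner_eq_iff:
  assumes "i \<in> {1..agents I}" "u \<in> universe I"
  shows "owner I u = i \<longleftrightarrow> u \<in> part I i"
proof -
  obtain j where j: "j \<in> {1..agents I}" "u \<in> part I j" using assms(2) by (auto simp: universe_def)
  have uniq: "k = j" if "k \<in> {1..agents I}" "u \<in> part I k" for k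
  proof (rule ccontr)
    assume "k \<noteq> j"
    moreover have "disjoint_family_on (part I) {1..agents I}"
      using inst unfolding rp_sp_instance_def by blast
    ultimately have "part I k \<inter> part I j = {}" using that(1) j(1) disjoint_family_onD by metis
    then show False using that(2) j(2) by blast
  qed
  have "owner I u = j" unfolding owner_def 
    by (rule the_equality) (use j uniq in blast)+
  then show ?thesis using uniq[OF assms(1)] j(2) by metis
qed

lemma owner_range: "u \<in> universe I \<Longrightarrow> owner I u \<in> {1..agents I}"
proof -
  assume u: "u \<in> universe I"
  then obtain j where "j \<in> {1..agents I}" "u \<in> part I j" by (auto simp: universe_def)
  then show ?thesis using owner_eq_iff[of j u] u by simp
qed

lemma part_eq:
  assumes "i \<in> {1..agents I}"
  shows "part I i = {v \<in> universe I. owner I v = i}"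
proof -
  have "part I i \<subseteq> universe I" using assms by (auto simp: universe_def)
  then show ?thesis using owner_eq_iff[OF assms] by auto
qed

text \<open>\<open>P\<close> is what remains of the packing once \<open>S\<close> is given up, with
  \<open>S = {}\<close> if nothing is rejected. Before and after, agent \<open>i\<close> has its
  elements of \<open>W - S\<close>; cancelling them leaves the newly covered elements against the
  loss inside \<open>S\<close>.\<close>

lemma improvement_iff:
  assumes i: "i \<in> {1..agents I}" and P: "P \<subseteq> sets I" "disjoint P" "\<Union>P = W - S"
    and S: "S \<subseteq> W" "W \<subseteq> universe I"
  shows "(\<exists>Xint. Xint \<subseteq> sets I \<and> (\<forall>T\<in>Xint. internal I i T) \<and> disjoint (P \<union> Xint) \<and>
      card (\<Union>(P \<union> Xint) \<inter> part I i) > card (W \<inter> part I i)) \<longleftrightarrow>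
    max_cover (own_sets I) (region I i W S) > card {v \<in> S. owner I v = i}" (is "?L \<longleftrightarrow> ?R")
proof -
  note part = part_eq[OF i]
  have finp: "finite (part I i)" using part finite_universe by simp
  have Si: "{v \<in> S. owner I v = i} = S \<inter> part I i" using S part by auto
  have card_W: "card (W \<inter> part I i) = card ((W - S) \<inter> part I i) + card (S \<inter> part I i)"
  proof -
    have "card (W \<inter> part I i) = card ((W - S) \<inter> part I i \<union> S \<inter> part I i)"
      by (rule arg_cong[of _ _ card]) (use S in blast)
    also have "\<dots> = card ((W - S) \<inter> part I i) + card (S \<inter> part I i)"
      by (rule card_Un_disjoint) (use finp in blast)+
    finally show ?thesis .
  qed
  have card_new: "card (((W - S) \<union> A) \<inter> part I i) = card ((W - S) \<inter> part I i) + card A"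
    if "A \<subseteq> region I i W S" for A
  proof -
    have "A \<subseteq> part I i" using that part by (auto simp: region_def)
    then have "card (((W - S) \<union> A) \<inter> part I i) = card ((W - S) \<inter> part I i \<union> A)"
      by (intro arg_cong[of _ _ card]) blast
    also have "\<dots> = card ((W - S) \<inter> part I i) + card A"
    proof (rule card_Un_disjoint)
      show "finite A" using \<open>A \<subseteq> part I i\<close> finp by (rule finite_subset)
    qed (use finp that in \<open>auto simp: region_def\<close>)
    finally show ?thesis .
  qed
  have fin: "finite (region I i W S)" using finite_universe by (simp add: region_def)
  show ?thesis
  proof
    assume ?L
    then obtain Z where Z: "Z \<subseteq> sets I" "\<forall>T\<in>Z. internal I i T" "disjoint (P \<union> Z)"
      "card (\<Union>(P \<union> Z) \<inter> part I i) > card (W \<inter> part I i)" by blast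
    \<comment> \<open>\<open>disjoint\<close> only separates distinct members, so an internal set
      may already belong to \<open>P\<close>. Such a set adds nothing; all others avoid everything
      that \<open>P\<close> covers.\<close>
    have "T \<inter> (W - S) = {}" if "T \<in> Z - P" for T
    proof -
      have "T \<inter> A = {}" if "A \<in> P" for A
        by (rule disjointD[OF Z(3)]) (use \<open>T \<in> Z - P\<close> that in auto)
      then show ?thesis unfolding P(3)[symmetric] by blast
    qed
    then have sub: "\<Union>(Z - P) \<subseteq> region I i W S"
      using Z(2) unfolding region_def internal_def part by blast
    have "packs (own_sets I) (region I i W S) (Z - P)"
    proof -
      have "one_owner I T" if "T \<in> Z" for T
        unfolding one_owner_def by (intro exI[of _ i]) (use Z(2) that in \<open>auto simp: part internal_def\<close>)
      then have "Z - P \<subseteq> own_sets I" using Z(1) by (auto simp: own_sets_def)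
      moreover have "disjoint (Z - P)" using Z(3) by (auto simp: disjoint_def)
      ultimately show ?thesis using sub by (simp add: packs_def)
    qed
    then have "card (\<Union>(Z - P)) \<le> max_cover (own_sets I) (region I i W S)"
      using le_max_cover_iff[OF fin] by blast
    moreover have "\<Union>(P \<union> Z) = (W - S) \<union> \<Union>(Z - P)" unfolding P(3)[symmetric] by blast
    ultimately show ?R using Z(4) card_new[OF sub] card_W Si by simp
  next
    assume ?R
    then obtain Z where Z: "packs (own_sets I) (region I i W S) Z" "card (S \<inter> part I i) < card (\<Union>Z)"
      using le_max_cover_iff[OF fin, of "max_cover (own_sets I) (region I i W S)" "own_sets I"]
      unfolding Si by (meson less_le_trans order_refl)
    have sub: "\<Union>Z \<subseteq> region I i W S" using Z(1) by (simp add: packs_def)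
    have "A \<inter> B = {}" if "A \<in> P" "B \<in> Z" for A B
    proof -
      have "A \<subseteq> W - S" using that P(3) by blast
      then show ?thesis using that sub by (auto simp: region_def)
    qed
    then have "\<Union>P \<inter> \<Union>Z = {}" by blast
    then have "disjoint (P \<union> Z)" using P(2) Z(1) disjoint_union unfolding packs_def by blast
    moreover have "\<forall>T\<in>Z. internal I i T" using sub part by (auto simp: internal_def region_def)
    moreover have "Z \<subseteq> sets I" using Z(1) by (auto simp: packs_def own_sets_def)
    moreover have "card (\<Union>(P \<union> Z) \<inter> part I i) > card (W \<inter> part I i)"
      using card_new[OF sub] card_W Z(2) P(3) by (simp add: Union_Un_distrib)
    ultimately show ?L by blast
  qed
qed

text \<open>Rejecting nothing is the case \<open>S = {}\<close>: the region then consists of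
  uncovered elements only, and there is no loss to make up for.\<close>

lemma one_rejects_iff:
  assumes i: "i \<in> {1..agents I}" and X: "X \<subseteq> sets I" "disjoint X"
  shows "one_rejects I i X \<longleftrightarrow> (\<exists>S\<in>insert {} X.
    max_cover (own_sets I) (region I i (\<Union>X) S) > card {v \<in> S. owner I v = i})"
proof -
  \<comment> \<open>\<open>card\<close> is 0 on infinite sets, so \<open>card Xrej \<le> 1\<close>
    means at most one set only once \<open>X\<close> is known to be finite.\<close>
  have finX: "finite X"
    by (rule finite_subset[of _ "Pow (universe I)"]) (use X sets_universe finite_universe in auto)
  have W: "\<Union>X \<subseteq> universe I" using X sets_universe by blast
  let ?imp = "\<lambda>P. \<exists>Xint. Xint \<subseteq> sets I \<and> (\<forall>T\<in>Xint. internal I i T) \<and> disjoint (P \<union> Xint) \<and>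
      card (\<Union>(P \<union> Xint) \<inter> part I i) > card (\<Union>X \<inter> part I i)"
  have "Xrej \<subseteq> X \<and> card Xrej \<le> 1 \<longleftrightarrow> Xrej = {} \<or> (\<exists>S\<in>X. Xrej = {S})" for Xrej
    using finX by (auto simp: le_Suc_eq card_1_singleton_iff dest: finite_subset)
  then have "one_rejects I i X \<longleftrightarrow> ?imp X \<or> (\<exists>S\<in>X. ?imp (X - {S}))"
  proof -
    assume *: "\<And>Xrej. Xrej \<subseteq> X \<and> card Xrej \<le> 1 \<longleftrightarrow> Xrej = {} \<or> (\<exists>S\<in>X. Xrej = {S})"
    have "one_rejects I i X \<longleftrightarrow> (\<exists>Xrej. (Xrej \<subseteq> X \<and> card Xrej \<le> 1) \<and> ?imp (X - Xrej))"
      unfolding one_rejects_def by blast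
    also have "\<dots> \<longleftrightarrow> ?imp (X - {}) \<or> (\<exists>S\<in>X. ?imp (X - {S}))" unfolding * by blast
    finally show ?thesis by simp
  qed
  moreover have "?imp X \<longleftrightarrow> max_cover (own_sets I) (region I i (\<Union>X) {}) > card {v \<in> {}. owner I v = i}"
    by (rule improvement_iff) (use i X W in auto)
  moreover have "?imp (X - {S}) \<longleftrightarrow> max_cover (own_sets I) (region I i (\<Union>X) S) > card {v \<in> S. owner I v = i}"
    if "S \<in> X" for S
    by (rule improvement_iff) (use i X W that in \<open>auto simp: disjoint_def\<close>)
  ultimately show ?thesis by auto
qed

lemma one_rejection_proof_iff:
  assumes X: "X \<subseteq> sets I" "disjoint X"
  shows "one_rejection_proof I X \<longleftrightarrow> (\<forall>S\<in>insert {} X. stable I (\<Union>X) S)"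
proof -
  \<comment> \<open>Bridges the quantifier over all agents in the problem and the one over owners of
    elements in \<open>stable\<close>.\<close>
  have nouniv: "max_cover (own_sets I) (region I i W S) = 0" if "i \<notin> owner I ` universe I" for i W S
  proof -
    have "region I i W S = {}" using that by (auto simp: region_def)
    then show ?thesis using max_cover_step[of "{}" "max_cover (own_sets I) {}" "own_sets I"] by auto
  qed
  have "one_rejection_proof I X \<longleftrightarrow> (\<forall>S\<in>insert {} X. \<forall>i\<in>{1..agents I}.
      max_cover (own_sets I) (region I i (\<Union>X) S) \<le> card {v \<in> S. owner I v = i})"
    unfolding one_rejection_proof_def by (auto simp: one_rejects_iff[OF _ X] not_less)
  also have "\<dots> \<longleftrightarrow> (\<forall>S\<in>insert {} X. stable I (\<Union>X) S)"
  proof (intro ball_cong refl iffI)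
    fix S assume "\<forall>i\<in>{1..agents I}. max_cover (own_sets I) (region I i (\<Union>X) S) \<le> card {v \<in> S. owner I v = i}"
    then show "stable I (\<Union>X) S" unfolding stable_def using owner_range by blast
  next
    fix S assume "stable I (\<Union>X) S"
    then show "\<forall>i\<in>{1..agents I}. max_cover (own_sets I) (region I i (\<Union>X) S) \<le> card {v \<in> S. owner I v = i}"
    proof (intro ballI)
      fix i
      show "max_cover (own_sets I) (region I i (\<Union>X) S) \<le> card {v \<in> S. owner I v = i}"
      proof (cases "i \<in> owner I ` universe I")
        case True
        then show ?thesis using \<open>stable I (\<Union>X) S\<close> by (auto simp: stable_def)
      next
        case False
        then show ?thesis using nouniv by simp
      qed
    qed
  qed
  finally show ?thesis .
qed

lemma yes_instance_iff:
  "yes_instance I \<longleftrightarrow> (\<exists>W\<subseteq>universe I. feasible I W W \<and> int (card W) \<ge> target I)"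
proof
  assume "yes_instance I"
  then obtain X where X: "X \<subseteq> sets I" "disjoint X" "one_rejection_proof I X" "int (card (\<Union>X)) \<ge> target I"
    by (auto simp: yes_instance_def)
  then have "feasible I (\<Union>X) (\<Union>X)" unfolding feasible_def exact_def using one_rejection_proof_iff[OF X(1,2)] by auto
  moreover have "\<Union>X \<subseteq> universe I" using X(1) sets_universe by blast
  ultimately show "\<exists>W\<subseteq>universe I. feasible I W W \<and> int (card W) \<ge> target I" using X(4) by blast
next
  assume "\<exists>W\<subseteq>universe I. feasible I W W \<and> int (card W) \<ge> target I"
  then obtain X where X: "X \<subseteq> {S \<in> sets I. stable I (\<Union>X) S}" "stable I (\<Union>X) {}" "disjoint X"
    "int (card (\<Union>X)) \<ge> target I" unfolding feasible_def exact_def by blast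
  then have "one_rejection_proof I X" by (subst one_rejection_proof_iff) auto
  then show "yes_instance I" unfolding yes_instance_def using X by blast
qed

end

subsection \<open>Programs on ternary vectors\<close>

notation Seq (infixr ";;" 60)

abbreviation (input) "rN \<equiv> 2 :: nat"
abbreviation (input) "rM \<equiv> 3 :: nat"
abbreviation (input) "rZero \<equiv> 4 :: nat"
abbreviation (input) "rOne \<equiv> 5 :: nat"
abbreviation (input) "rTwo \<equiv> 6 :: nat"
abbreviation (input) "rRows \<equiv> 7 :: nat"
abbreviation (input) "rTarget \<equiv> 8 :: nat"
abbreviation (input) "rIdx \<equiv> 9 :: nat"
abbreviation (input) "rIdx3 \<equiv> 10 :: nat"
abbreviation (input) "rCarry \<equiv> 11 :: nat"
abbreviation (input) "rPtr \<equiv> 12 :: nat"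
abbreviation (input) "rRow \<equiv> 13 :: nat"
abbreviation (input) "rV \<equiv> 14 :: nat"
abbreviation (input) "rX \<equiv> 15 :: nat"
abbreviation (input) "rY \<equiv> 16 :: nat"
abbreviation (input) "rOk \<equiv> 17 :: nat"
abbreviation (input) "rCnt \<equiv> 18 :: nat"
abbreviation (input) "rOwner \<equiv> 19 :: nat"
abbreviation (input) "rAcc \<equiv> 20 :: nat"
abbreviation (input) "rH \<equiv> 21 :: nat"
abbreviation (input) "rW \<equiv> 22 :: nat"
abbreviation (input) "rU \<equiv> 23 :: nat"
abbreviation (input) "rAgent \<equiv> 24 :: nat"
abbreviation (input) "rCntA \<equiv> 25 :: nat"
abbreviation (input) "rOnes \<equiv> 26 :: nat"
abbreviation (input) "rTwos \<equiv> 27 :: nat"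

abbreviation (input) "aDigits \<equiv> 2 :: nat"
abbreviation (input) "aTriple \<equiv> 3 :: nat"
abbreviation (input) "aCover \<equiv> 4 :: nat"
abbreviation (input) "aFeas \<equiv> 5 :: nat"
abbreviation (input) "aRest \<equiv> 6 :: nat"
abbreviation (input) "aSet \<equiv> 7 :: nat"
abbreviation (input) "aOwner \<equiv> 8 :: nat"
abbreviation (input) "aRegion \<equiv> 9 :: nat"

text \<open>The language has no empty command. This one costs a time unit, and the frame counts
  \<open>rX\<close> as written.\<close>

abbreviation (input) "skip \<equiv> Copy rX rX"

text \<open>Tests compare two registers, so the constants 0, 1 and 2 have to sit in registers.
  \<open>L\<close> is a strict bound on \<open>n\<close> and the unit in which running times are
  stated.\<close>

definition consts_ok :: "nat \<Rightarrow> nat \<Rightarrow> regs \<Rightarrow> bool" where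
  "consts_ok n L r \<longleftrightarrow> r rN = n \<and> n < L \<and> r rZero = 0 \<and> r rOne = 1 \<and> r rTwo = 2"

section \<open>Base-3 values of digit vectors\<close>

definition idx :: "nat \<Rightarrow> (nat \<Rightarrow> nat) \<Rightarrow> nat" where
  "idx n t = (\<Sum>v<n. t v * 3 ^ v)"

lemma idx_0 [simp]: "idx 0 t = 0"
  by (simp add: idx_def)

lemma idx_Suc: "idx (Suc n) t = t 0 + 3 * idx n (\<lambda>v. t (Suc v))"
  unfolding idx_def by (subst sum.lessThan_Suc_shift) (simp add: sum_distrib_left algebra_simps)

text \<open>Position 0 is least significant: the first \<open>a\<close> digits form the low part,
  the next \<open>b\<close> digits the high part, which \<open>horner\<close> reads first.\<close>

lemma idx_add: "idx (a + b) t = idx a t + 3 ^ a * idx b (\<lambda>v. t (a + v))"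
proof (induction a arbitrary: t)
  case (Suc a)
  show ?case using Suc[of "\<lambda>v. t (Suc v)"] by (simp add: idx_Suc algebra_simps)
qed simp

lemma idx_less: "(\<And>v. v < n \<Longrightarrow> t v < 3) \<Longrightarrow> idx n t < 3 ^ n"
proof (induction n arbitrary: t)
  case (Suc n)
  have "idx n (\<lambda>v. t (Suc v)) < 3 ^ n" using Suc by simp
  moreover have "t 0 < 3" using Suc by simp
  ultimately show ?case by (simp add: idx_Suc)
qed simp

lemma idx_cong: "(\<And>v. v < n \<Longrightarrow> t v = t' v) \<Longrightarrow> idx n t = idx n t'"
  by (simp add: idx_def)

text \<open>In additive form, since the value may go down and subtraction on naturals is
  truncated.\<close>

lemma idx_upd:
  assumes "k < n"
  shows "idx n (t(k := x)) + t k * 3 ^ k = idx n t + x * 3 ^ k"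
proof -
  have "idx n s = s k * 3 ^ k + (\<Sum>v\<in>{..<n} - {k}. s v * 3 ^ v)" for s
    unfolding idx_def using assms by (subst sum.remove[of _ k]) auto
  from this[of t] this[of "t(k := x)"] show ?thesis by simp
qed

lemma idx_eq_0: "idx n t = 0 \<Longrightarrow> v < n \<Longrightarrow> t v = 0"
  by (simp add: idx_def)

lemma idx_strict_mono:
  assumes "\<And>v. v < n \<Longrightarrow> t v \<le> t' v" "v < n" "t v < t' v"
  shows "idx n t < idx n t'"
  unfolding idx_def by (rule sum_strict_mono_ex1) (use assms in auto)

text \<open>Uniqueness of ternary notation: the digit at place 0 is the remainder modulo 3, and the
  quotient is the index of the shifted vector.\<close>

lemma idx_eqD:
  assumes "idx n t = idx n t'" "\<And>v. v < n \<Longrightarrow> t v < 3" "\<And>v. v < n \<Longrightarrow> t' v < 3" "v < n"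
  shows "t v = t' v"
  using assms
proof (induction n arbitrary: t t' v)
  case (Suc n)
  have eq: "t 0 + 3 * idx n (\<lambda>v. t (Suc v)) = t' 0 + 3 * idx n (\<lambda>v. t' (Suc v))"
    using Suc.prems(1) by (simp add: idx_Suc)
  moreover have "t 0 < 3" "t' 0 < 3" using Suc.prems(2,3) by auto
  ultimately have "t 0 = t' 0" "idx n (\<lambda>v. t (Suc v)) = idx n (\<lambda>v. t' (Suc v))" by presburger+
  then show ?case using Suc.IH[of "\<lambda>v. t (Suc v)" "\<lambda>v. t' (Suc v)"] Suc.prems by (cases v) auto
qed simp

section \<open>Elementary programs on one vector\<close>

definition copy_row :: "nat \<Rightarrow> com" where
  "copy_row a = For rV rN (Load rX 0 rPtr ;; Store a rV rX ;; Inc rPtr)"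

definition horner :: "nat \<Rightarrow> com" where
  "horner a = Const rH 0 ;; Copy rW rN ;;
     For rV rN (Dec rW ;; Load rH aTriple rH ;; Load rX a rW ;;
       Cond (Equal rX rOne) (Inc rH) (Cond (Equal rX rTwo) (Inc rH ;; Inc rH) skip))"

definition increment :: com where
  "increment = Const rCarry 1 ;;
     For rV rN (Cond (Equal rCarry rOne)
       (Load rX aDigits rV ;;
        Cond (Equal rX rTwo) (Store aDigits rV rZero) (Inc rX ;; Store aDigits rV rX ;; Const rCarry 0))
       skip)"

text \<open>An empty set is refused because its rest would have the index of the very entry being
  computed. The counter doubles as the size of the set for \<open>add_cover\<close>.\<close>

definition subtract :: com where
  "subtract = Const rOk 1 ;; Const rCnt 0 ;;
     For rV rN (Load rX aDigits rV ;; Load rY aSet rV ;;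
       Cond (Equal rY rOne) (Inc rCnt ;; Cond (Equal rX rTwo) (Const rX 1) (Const rOk 0)) skip ;;
       Store aRest rV rX) ;;
     Cond (Equal rCnt rZero) (Const rOk 0) skip"

text \<open>Owners are positive, so \<open>0\<close> in \<open>rOwner\<close> means that no element has been seen yet.\<close>

definition check_owner :: com where
  "check_owner = Const rOwner 0 ;;
     For rV rN (Load rY aSet rV ;;
       Cond (Equal rY rOne)
         (Load rY aOwner rV ;;
          Cond (Equal rOwner rZero) (Copy rOwner rY) (Cond (Equal rOwner rY) skip (Const rOk 0)))
         skip)"

text \<open>Only digits 0 and 2 are written: an entry of the cover table depends on the places of
  digit 2 alone.\<close>

definition make_region :: com where
  "make_region = Const rCntA 0 ;;
     For rV rN (Load rY aOwner rV ;; Const rX 0 ;;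
       Cond (Equal rY rAgent)
         (Load rY aSet rV ;;
          Cond (Equal rY rOne) (Inc rCntA ;; Const rX 2)
            (Load rY aDigits rV ;; Cond (Equal rY rZero) (Const rX 2) skip))
         skip ;;
       Store aRegion rV rX)"

text \<open>Never sets \<open>rOk\<close> to 1, so its verdict is conjoined with what was found
  before. An owner of several elements is tested several times; in return the loop has
  \<open>n\<close> rounds, however many agents there are.\<close>

definition check_stable :: com where
  "check_stable = For rU rN (Load rAgent aOwner rU ;; make_region ;; horner aRegion ;; Load rX aCover rH ;;
       Cond (Less rCntA rX) (Const rOk 0) skip)"

lemma writes_blocks [simp]:
  "wregs (copy_row a) = {rV, rX, rPtr}" "warrs (copy_row a) = {a}"
  "wregs (horner a) = {rV, rX, rH, rW}" "warrs (horner a) = {}"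
  "wregs increment = {rV, rX, rCarry}" "warrs increment = {aDigits}"
  "wregs subtract = {rV, rX, rY, rOk, rCnt}" "warrs subtract = {aRest}"
  "wregs check_owner = {rV, rX, rY, rOk, rOwner}" "warrs check_owner = {}"
  "wregs make_region = {rV, rX, rY, rCntA}" "warrs make_region = {aRegion}"
  "wregs check_stable = {rU, rAgent, rV, rX, rY, rCntA, rH, rW, rOk}" "warrs check_stable = {aRegion}"
  unfolding copy_row_def horner_def increment_def subtract_def check_owner_def make_region_def check_stable_def
  by auto

section \<open>Correctness and cost of the elementary programs\<close>

lemma runs_copy_row:
  assumes "consts_ok n L r" "a \<noteq> 0"
  shows "runs (copy_row a) r m (5 * L)
    (\<lambda>r' m'. r' rPtr = r rPtr + n \<and> (\<forall>v<n. m' a v = m 0 (r rPtr + v)))"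
proof -
  have n: "r rN = n" "n < L" using assms by (auto simp: consts_ok_def)
  have "runs (copy_row a) r m ((3 + 2) * L)
      ((\<lambda>k r' m'. r' rPtr = r rPtr + k \<and> (\<forall>v<k. m' a v = m 0 (r rPtr + v))) (r rN))"
    unfolding copy_row_def
    by (rule runs_For) (use n assms(2) in \<open>auto simp: frame_def less_Suc_eq\<close>)
  then show ?thesis by (simp add: n)
qed

text \<open>Correct triples are demanded only up to the final value, because the first sweep has not
  filled the array any further. This suffices: each intermediate value is that of a block of high
  digits read on its own, hence at most the final one.\<close>

lemma runs_horner:
  assumes "consts_ok n L r" "\<And>v. v < n \<Longrightarrow> m a v < 3"
    and "\<And>j. j \<le> idx n (m a) \<Longrightarrow> m aTriple j = 3 * j"
  shows "runs (horner a) r m (9 * L + 2) (\<lambda>r' m'. r' rH = idx n (m a))"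
proof -
  have c: "r rN = n" "n < L" "r rOne = 1" "r rTwo = 2" using assms by (auto simp: consts_ok_def)
  let ?r = "r(rH := 0, rW := r rN)"
  let ?I = "\<lambda>k (r' :: regs) (m' :: arrs). r' rW = n - k \<and> r' rH = idx k (\<lambda>v. m a (n - k + v))"
  let ?c = "Dec rW ;; Load rH aTriple rH ;; Load rX a rW ;;
       Cond (Equal rX rOne) (Inc rH) (Cond (Equal rX rTwo) (Inc rH ;; Inc rH) skip)"
  have "runs (For rV rN ?c) ?r m ((7 + 2) * L) (?I (?r rN))"
  proof (rule runs_For)
    fix k r' m'
    assume k: "k < ?r rN" "r' rV = k" and I: "?I k r' m'" and f: "frame (For rV rN ?c) ?r m r' m'"
    have mm: "m' = m" using f by (auto simp: frame_def)
    have cs: "r' rOne = 1" "r' rTwo = 2" using f c by (auto simp: frame_def)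
    have kn: "k < n" using k c by simp
    then have nk: "n - k = Suc (n - Suc k)" by simp
    let ?w = "n - Suc k"
    have step: "idx (Suc k) (\<lambda>v. m a (?w + v)) = m a ?w + 3 * idx k (\<lambda>v. m a (n - k + v))"
      by (simp add: idx_Suc nk)
    have "idx n (m a) = idx (n - k) (m a) + 3 ^ (n - k) * idx k (\<lambda>v. m a (n - k + v))"
      using idx_add[of "n - k" k "m a"] kn by simp
    moreover have "idx k (\<lambda>v. m a (n - k + v)) \<le> 3 ^ (n - k) * idx k (\<lambda>v. m a (n - k + v))" by simp
    ultimately have "idx k (\<lambda>v. m a (n - k + v)) \<le> idx n (m a)" by linarith
    then have tr: "m aTriple (r' rH) = 3 * idx k (\<lambda>v. m a (n - k + v))" using assms(3) I by simp
    have d: "m a ?w < 3" using assms(2) kn by simp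
    show "runs ?c r' m' 7 (\<lambda>r'' m''. ?I (Suc k) (r''(rV := Suc k)) m'')"
      using d I cs tr by (auto simp: mm step)
  qed (use c in \<open>auto simp: frame_def\<close>)
  then have "runs (For rV rN ?c) ?r m (9 * L) (\<lambda>r' m'. r' rH = idx n (m a))"
    by (rule runs_mono) (use c in auto)
  then show ?thesis by (simp add: horner_def)
qed

text \<open>The pending carry has weight \<open>3 ^ k\<close> after \<open>k\<close> places, and
  value plus weighted carry stays constant. A carry that survives all \<open>n\<close> places means
  that a vector of digits 2 has wrapped to zeros.\<close>

lemma runs_increment:
  assumes "consts_ok n L r" "\<And>v. v < n \<Longrightarrow> m aDigits v < 3"
  shows "runs increment r m (8 * L + 1) (\<lambda>r' m'. r' rCarry \<le> 1 \<and> (\<forall>v<n. m' aDigits v < 3) \<and>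
    idx n (m aDigits) + 1 = idx n (m' aDigits) + r' rCarry * 3 ^ n)"
proof -
  have c: "r rN = n" "n < L" "r rOne = 1" "r rTwo = 2" "r rZero = 0" using assms by (auto simp: consts_ok_def)
  let ?r = "r(rCarry := 1)"
  let ?I = "\<lambda>k (r' :: regs) (m' :: arrs). r' rCarry \<le> 1 \<and> (\<forall>v<n. m' aDigits v < 3) \<and>
    idx n (m aDigits) + 1 = idx n (m' aDigits) + r' rCarry * 3 ^ k"
  let ?c = "Cond (Equal rCarry rOne)
       (Load rX aDigits rV ;;
        Cond (Equal rX rTwo) (Store aDigits rV rZero) (Inc rX ;; Store aDigits rV rX ;; Const rCarry 0))
       skip"
  have "runs (For rV rN ?c) ?r m ((6 + 2) * L) (?I (?r rN))"
  proof (rule runs_For)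
    fix k r' m'
    assume k: "k < ?r rN" "r' rV = k" and I: "?I k r' m'" and f: "frame (For rV rN ?c) ?r m r' m'"
    have cs: "r' rOne = 1" "r' rTwo = 2" "r' rZero = 0" using f c by (auto simp: frame_def)
    have kn: "k < n" using k c by simp
    then have d: "m' aDigits k < 3" using I by simp
    note upd = idx_upd[OF kn, of "m' aDigits"]
    show "runs ?c r' m' 6 (\<lambda>r'' m''. ?I (Suc k) (r''(rV := Suc k)) m'')"
    proof (cases "r' rCarry = 1")
      case True
      then have e: "idx n (m aDigits) + 1 = idx n (m' aDigits) + 3 ^ k" using I by simp
      show ?thesis
      proof (cases "m' aDigits k = 2")
        case two: True
        then show ?thesis using True I cs k e upd[of 0] by simp
      next
        case False
        then have "Suc (m' aDigits k) < 3" using d by simp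
        then show ?thesis using False True I cs k e upd[of "Suc (m' aDigits k)"] by simp
      qed
    next
      case False
      then show ?thesis using I cs by simp
    qed
  qed (use c assms(2) in \<open>auto simp: frame_def\<close>)
  then have "runs (For rV rN ?c) ?r m (8 * L) (?I n)"
    by (rule runs_mono) (use c in auto)
  then show ?thesis by (simp add: increment_def)
qed

lemma runs_subtract:
  assumes "consts_ok n L r"
  shows "runs subtract r m (9 * L + 4) (\<lambda>r' m'. r' rCnt = card {v. v < n \<and> m aSet v = 1} \<and>
    r' rOk = (if (\<exists>v<n. m aSet v = 1) \<and> (\<forall>v<n. m aSet v = 1 \<longrightarrow> m aDigits v = 2) then 1 else 0) \<and>
    (\<forall>v<n. m' aRest v = (if m aSet v = 1 \<and> m aDigits v = 2 then 1 else m aDigits v)))"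
proof -
  have c: "r rN = n" "n < L" "r rOne = 1" "r rTwo = 2" "r rZero = 0" using assms by (auto simp: consts_ok_def)
  let ?r = "r(rOk := 1, rCnt := 0)"
  let ?I = "\<lambda>k (r' :: regs) (m' :: arrs). r' rCnt = card {v. v < k \<and> m aSet v = 1} \<and>
    r' rOk = (if \<forall>v<k. m aSet v = 1 \<longrightarrow> m aDigits v = 2 then 1 else 0) \<and>
    (\<forall>v<k. m' aRest v = (if m aSet v = 1 \<and> m aDigits v = 2 then 1 else m aDigits v))"
  let ?c = "Load rX aDigits rV ;; Load rY aSet rV ;;
       Cond (Equal rY rOne) (Inc rCnt ;; Cond (Equal rX rTwo) (Const rX 1) (Const rOk 0)) skip ;;
       Store aRest rV rX"
  have *: "runs (For rV rN ?c) ?r m ((7 + 2) * L) (?I (?r rN))"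
  proof (rule runs_For)
    fix k r' m'
    assume k: "k < ?r rN" "r' rV = k" and I: "?I k r' m'" and f: "frame (For rV rN ?c) ?r m r' m'"
    have cs: "r' rOne = 1" "r' rTwo = 2" using f c by (auto simp: frame_def)
    have ma: "m' aSet = m aSet" "m' aDigits = m aDigits" using f by (auto simp: frame_def)
    have s: "{v. v < Suc k \<and> m aSet v = 1} =
        (if m aSet k = 1 then insert k {v. v < k \<and> m aSet v = 1} else {v. v < k \<and> m aSet v = 1})"
      by (auto simp: less_Suc_eq)
    then have card: "card {v. v < Suc k \<and> m aSet v = 1} =
        (if m aSet k = 1 then Suc (card {v. v < k \<and> m aSet v = 1}) else card {v. v < k \<and> m aSet v = 1})"
      by simp
    show "runs ?c r' m' 7 (\<lambda>r'' m''. ?I (Suc k) (r''(rV := Suc k)) m'')"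
      using I cs k ma card by (auto simp: less_Suc_eq)
  qed (use c in \<open>auto simp: frame_def\<close>)
  have "runs (For rV rN ?c ;; Cond (Equal rCnt rZero) (Const rOk 0) skip) ?r m (9 * L + 2)
    (\<lambda>r' m'. r' rCnt = card {v. v < n \<and> m aSet v = 1} \<and>
    r' rOk = (if (\<exists>v<n. m aSet v = 1) \<and> (\<forall>v<n. m aSet v = 1 \<longrightarrow> m aDigits v = 2) then 1 else 0) \<and>
    (\<forall>v<n. m' aRest v = (if m aSet v = 1 \<and> m aDigits v = 2 then 1 else m aDigits v)))"
  proof (rule runs_Seq[OF *])
    fix r' m' assume I: "?I (?r rN) r' m'" and f: "frame (For rV rN ?c) ?r m r' m'"
    have cs: "r' rZero = 0" using f c by (auto simp: frame_def)
    have "card {v. v < n \<and> m aSet v = 1} = 0 \<longleftrightarrow> \<not> (\<exists>v<n. m aSet v = 1)" by auto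
    then show "runs (Cond (Equal rCnt rZero) (Const rOk 0) skip) r' m' (9 * L + 2 - (7 + 2) * L)
      (\<lambda>r' m'. r' rCnt = card {v. v < n \<and> m aSet v = 1} \<and>
    r' rOk = (if (\<exists>v<n. m aSet v = 1) \<and> (\<forall>v<n. m aSet v = 1 \<longrightarrow> m aDigits v = 2) then 1 else 0) \<and>
    (\<forall>v<n. m' aRest v = (if m aSet v = 1 \<and> m aDigits v = 2 then 1 else m aDigits v)))"
      using I cs c by simp
  qed simp
  then show ?thesis by (simp add: subtract_def)
qed

lemma runs_check_owner:
  assumes "consts_ok n L r" "r rOk \<le> 1" "\<And>v. v < n \<Longrightarrow> m aOwner v \<noteq> 0"
  shows "runs check_owner r m (8 * L + 1) (\<lambda>r' m'.
    r' rOk = (if r rOk = 1 \<and> (\<exists>i. \<forall>v<n. m aSet v = 1 \<longrightarrow> m aOwner v = i) then 1 else 0))"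
proof -
  have c: "r rN = n" "n < L" "r rOne = 1" "r rTwo = 2" "r rZero = 0" using assms by (auto simp: consts_ok_def)
  let ?r = "r(rOwner := 0)"
  \<comment> \<open>The third conjunct supplies a member whose owner is \<open>rOwner\<close>, so a
    common owner can only be \<open>rOwner\<close>. After a conflict \<open>rOwner\<close> is kept
    and \<open>rOk\<close> stays 0.\<close>
  let ?I = "\<lambda>k (r' :: regs) (m' :: arrs). (r' rOwner = 0 \<longleftrightarrow> (\<forall>v<k. m aSet v \<noteq> 1)) \<and>
    r' rOk = (if r rOk = 1 \<and> (\<forall>v<k. m aSet v = 1 \<longrightarrow> m aOwner v = r' rOwner) then 1 else 0) \<and>
    (r' rOwner \<noteq> 0 \<longrightarrow> (\<exists>v<k. m aSet v = 1 \<and> m aOwner v = r' rOwner))"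
  let ?c = "Load rY aSet rV ;;
       Cond (Equal rY rOne)
         (Load rY aOwner rV ;;
          Cond (Equal rOwner rZero) (Copy rOwner rY) (Cond (Equal rOwner rY) skip (Const rOk 0)))
         skip"
  have "runs (For rV rN ?c) ?r m ((6 + 2) * L) (?I (?r rN))"
  proof (rule runs_For)
    fix k r' m'
    assume k: "k < ?r rN" "r' rV = k" and I: "?I k r' m'" and f: "frame (For rV rN ?c) ?r m r' m'"
    have cs: "r' rOne = 1" "r' rZero = 0" using f c by (auto simp: frame_def)
    have ma: "m' = m" using f by (auto simp: frame_def)
    have o: "m aOwner k \<noteq> 0" using assms(3) k c by simp
    show "runs ?c r' m' 6 (\<lambda>r'' m''. ?I (Suc k) (r''(rV := Suc k)) m'')"
    proof (cases "m aSet k = 1")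
      case True
      then show ?thesis using I cs k ma o by (auto simp: less_Suc_eq)
    next
      case False
      then show ?thesis using I cs k ma by (auto simp: less_Suc_eq)
    qed
  qed (use c assms(2) in \<open>auto simp: frame_def\<close>)
  then have "runs (For rV rN ?c) ?r m (8 * L) (\<lambda>r' m'.
    r' rOk = (if r rOk = 1 \<and> (\<exists>i. \<forall>v<n. m aSet v = 1 \<longrightarrow> m aOwner v = i) then 1 else 0))"
  proof (rule runs_mono)
    fix r' m' assume I: "?I (?r rN) r' m'"
    have "(\<exists>i. \<forall>v<n. m aSet v = 1 \<longrightarrow> m aOwner v = i) \<longleftrightarrow> (\<forall>v<n. m aSet v = 1 \<longrightarrow> m aOwner v = r' rOwner)"
      using I c by (cases "r' rOwner = 0") auto
    then show "r' rOk = (if r rOk = 1 \<and> (\<exists>i. \<forall>v<n. m aSet v = 1 \<longrightarrow> m aOwner v = i) then 1 else 0)"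
      using I c by simp
  qed simp
  then show ?thesis by (simp add: check_owner_def)
qed

lemma runs_make_region:
  assumes "consts_ok n L r"
  shows "runs make_region r m (11 * L + 1) (\<lambda>r' m'.
    r' rCntA = card {v. v < n \<and> m aSet v = 1 \<and> m aOwner v = r rAgent} \<and>
    (\<forall>v<n. m' aRegion v =
      (if m aOwner v = r rAgent \<and> (m aSet v = 1 \<or> m aDigits v = 0) then 2 else 0)))"
proof -
  have c: "r rN = n" "n < L" "r rOne = 1" "r rTwo = 2" "r rZero = 0" using assms by (auto simp: consts_ok_def)
  let ?r = "r(rCntA := 0)"
  let ?P = "\<lambda>v. m aSet v = 1 \<and> m aOwner v = r rAgent"
  let ?I = "\<lambda>k (r' :: regs) (m' :: arrs). r' rCntA = card {v. v < k \<and> ?P v} \<and>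
    (\<forall>v<k. m' aRegion v = (if m aOwner v = r rAgent \<and> (m aSet v = 1 \<or> m aDigits v = 0) then 2 else 0))"
  let ?c = "Load rY aOwner rV ;; Const rX 0 ;;
       Cond (Equal rY rAgent)
         (Load rY aSet rV ;;
          Cond (Equal rY rOne) (Inc rCntA ;; Const rX 2)
            (Load rY aDigits rV ;; Cond (Equal rY rZero) (Const rX 2) skip))
         skip ;;
       Store aRegion rV rX"
  have "runs (For rV rN ?c) ?r m ((9 + 2) * L) (?I (?r rN))"
  proof (rule runs_For)
    fix k r' m'
    assume k: "k < ?r rN" "r' rV = k" and I: "?I k r' m'" and f: "frame (For rV rN ?c) ?r m r' m'"
    have cs: "r' rOne = 1" "r' rZero = 0" "r' rAgent = r rAgent" using f c by (auto simp: frame_def)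
    have ma: "m' aSet = m aSet" "m' aDigits = m aDigits" "m' aOwner = m aOwner" using f by (auto simp: frame_def)
    have s: "{v. v < Suc k \<and> ?P v} = (if ?P k then insert k {v. v < k \<and> ?P v} else {v. v < k \<and> ?P v})"
      by (auto simp: less_Suc_eq)
    then have card: "card {v. v < Suc k \<and> ?P v} =
        (if ?P k then Suc (card {v. v < k \<and> ?P v}) else card {v. v < k \<and> ?P v})"
      by simp
    show "runs ?c r' m' 9 (\<lambda>r'' m''. ?I (Suc k) (r''(rV := Suc k)) m'')"
      using I cs k ma card by (auto simp: less_Suc_eq)
  qed (use c in \<open>auto simp: frame_def\<close>)
  then show ?thesis using c by (simp add: make_region_def)
qed

definition region_digits :: "arrs \<Rightarrow> nat \<Rightarrow> nat \<Rightarrow> nat" where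
  "region_digits m i v = (if m aOwner v = i \<and> (m aSet v = 1 \<or> m aDigits v = 0) then 2 else 0)"

lemma runs_check_stable:
  assumes "consts_ok n L r" "r rOk \<le> 1" "\<And>j. j < 3 ^ n \<Longrightarrow> m aTriple j = 3 * j"
  shows "runs check_stable r m ((20 * L + 9) * L) (\<lambda>r' m'. r' rOk = (if r rOk = 1 \<and>
    (\<forall>u<n. m aCover (idx n (region_digits m (m aOwner u)))
       \<le> card {v. v < n \<and> m aSet v = 1 \<and> m aOwner v = m aOwner u}) then 1 else 0))"
proof -
  have c: "r rN = n" "n < L" "r rOne = 1" "r rTwo = 2" "r rZero = 0" using assms by (auto simp: consts_ok_def)
  let ?P = "\<lambda>u. m aCover (idx n (region_digits m (m aOwner u)))
       \<le> card {v. v < n \<and> m aSet v = 1 \<and> m aOwner v = m aOwner u}"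
  let ?I = "\<lambda>k (r' :: regs) (m' :: arrs). r' rOk = (if r rOk = 1 \<and> (\<forall>u<k. ?P u) then 1 else 0)"
  let ?c2 = "Load rX aCover rH ;; Cond (Less rCntA rX) (Const rOk 0) skip"
  let ?c1 = "make_region ;; horner aRegion ;; ?c2"
  let ?c = "Load rAgent aOwner rU ;; ?c1"
  have "runs (For rU rN ?c) r m ((20 * L + 7 + 2) * L) (?I (r rN))"
  proof (rule runs_For)
    fix k r' m'
    assume k: "k < r rN" "r' rU = k" and I: "?I k r' m'" and f: "frame (For rU rN ?c) r m r' m'"
    \<comment> \<open>A folded \<open>Q\<close> passes unchanged through symbolic execution and is
      unfolded only where it is proved. The same device recurs below.\<close>
    define Q where "Q = (\<lambda>r'' m''. ?I (Suc k) (r''(rU := Suc k)) m'')"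
    have ma: "m' a = m a" if "a \<noteq> aRegion" for a using f that by (auto simp: frame_def)
    let ?r = "r'(rAgent := m' aOwner (r' rU))"
    have ok: "consts_ok n L ?r" using f c by (auto simp: frame_def consts_ok_def)
    have "runs ?c1 ?r m' (20 * L + 6) Q"
    proof (rule runs_Seq[OF runs_make_region[OF ok]])
      fix r1 m1
      assume 1: "r1 rCntA = card {v. v < n \<and> m' aSet v = 1 \<and> m' aOwner v = ?r rAgent} \<and>
        (\<forall>v<n. m1 aRegion v = (if m' aOwner v = ?r rAgent \<and> (m' aSet v = 1 \<or> m' aDigits v = 0) then 2 else 0))"
        and f1: "frame make_region ?r m' r1 m1"
      have ok1: "consts_ok n L r1" using f1 ok by (auto simp: frame_def consts_ok_def)
      have ma1: "m1 a = m a" if "a \<noteq> aRegion" for a using f1 ma that by (auto simp: frame_def)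
      have reg: "m1 aRegion v = region_digits m (m aOwner k) v" if "v < n" for v
        using 1 that ma k by (simp add: region_digits_def)
      then have idx: "idx n (m1 aRegion) = idx n (region_digits m (m aOwner k))" by (rule idx_cong)
      have lt: "m1 aRegion v < 3" if "v < n" for v using reg[OF that] by (simp add: region_digits_def)
      have bound: "idx n (m1 aRegion) < 3 ^ n" using idx_less lt by blast
      have "runs (horner aRegion ;; ?c2) r1 m1 (9 * L + 5) Q"
      proof (rule runs_Seq[OF runs_horner[OF ok1]])
        fix r2 m2 assume 2: "r2 rH = idx n (m1 aRegion)" and f2: "frame (horner aRegion) r1 m1 r2 m2"
        have m2: "m2 aCover = m aCover" using f2 ma1 by (auto simp: frame_def)
        have "r2 rCntA = card {v. v < n \<and> m aSet v = 1 \<and> m aOwner v = m aOwner k}"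
          using f2 1 k ma by (simp add: frame_def)
        moreover have "r2 rOk = r' rOk" using f2 f1 by (simp add: frame_def)
        ultimately show "runs ?c2 r2 m2 (9 * L + 5 - (9 * L + 2)) Q"
          using I 2 m2 idx by (auto simp: less_Suc_eq Q_def)
      qed (use lt bound assms(3) ma1 in auto)
      then show "runs (horner aRegion ;; ?c2) r1 m1 (20 * L + 6 - (11 * L + 1)) Q"
        by (rule runs_le) simp
    qed simp
    then have "runs ?c r' m' (20 * L + 7) Q" by (simp add: add.commute)
    then show "runs ?c r' m' (20 * L + 7) (\<lambda>r'' m''. ?I (Suc k) (r''(rU := Suc k)) m'')"
      unfolding Q_def .
  qed (use c assms(2) in \<open>auto simp: frame_def\<close>)
  then show ?thesis unfolding check_stable_def by (rule runs_mono) (use c in simp_all)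
qed


subsection \<open>Sweeping over all ternary vectors\<close>

text \<open>Multiplication is not available, so \<open>horner\<close> reads triples off \<open>aTriple\<close>. The sweep fills this
  array on the fly: at step \<open>k\<close> all cells up to \<open>k\<close> are correct, which is enough for the indices
  below \<open>k\<close> that the first sweep looks up.\<close>

definition sweep :: "com \<Rightarrow> com" where
  "sweep c = Const rIdx 0 ;; Const rIdx3 0 ;; Const rCarry 0 ;;
     While (Equal rCarry rZero)
       (Store aTriple rIdx rIdx3 ;; c ;; Inc rIdx ;; Inc rIdx3 ;; Inc rIdx3 ;; Inc rIdx3 ;; increment)"

lemma writes_sweep [simp]:
  "wregs (sweep c) = wregs c \<union> {rIdx, rIdx3, rCarry, rV, rX}" "warrs (sweep c) = warrs c \<union> {aTriple, aDigits}"
  unfolding sweep_def by auto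

text \<open>Besides the counters of the sweep itself, only the answer in register 0 and the table
  \<open>G\<close> carry information from one vector to the next, so \<open>Inv\<close> sees nothing
  else. The second disjunct about \<open>aTriple\<close> preserves cells that were right at the
  start; it gives a second sweep the full array from its first step.\<close>

lemma runs_sweep:
  assumes ok: "consts_ok n L r" and zero: "\<And>v. v < n \<Longrightarrow> m aDigits v = 0"
    and w: "wregs c \<inter> {rN, rZero, rOne, rTwo, rIdx, rIdx3, rCarry} = {}" "warrs c \<inter> {aDigits, aTriple} = {}"
    and G: "G \<notin> {aDigits, aTriple}"
    and init: "Inv 0 (r 0) (m G)"
    and step: "\<And>k r' m'. k < 3 ^ n \<Longrightarrow> r' rIdx = k \<Longrightarrow> idx n (m' aDigits) = k \<Longrightarrow>
      (\<forall>v<n. m' aDigits v < 3) \<Longrightarrow> (\<forall>j. j \<le> k \<or> m aTriple j = 3 * j \<longrightarrow> m' aTriple j = 3 * j) \<Longrightarrow>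
      frame (sweep c) r m r' m' \<Longrightarrow> Inv k (r' 0) (m' G) \<Longrightarrow>
      runs c r' m' T (\<lambda>r'' m''. Inv (Suc k) (r'' 0) (m'' G))"
  shows "runs (sweep c) r m (3 ^ n * (T + 8 * L + 7) + 4) (\<lambda>r' m'. Inv (3 ^ n) (r' 0) (m' G) \<and>
    (\<forall>v<n. m' aDigits v = 0) \<and> (\<forall>j<3 ^ n. m' aTriple j = 3 * j))"
proof -
  have cs: "r rN = n" "n < L" "r rOne = 1" "r rTwo = 2" "r rZero = 0" using ok by (auto simp: consts_ok_def)
  \<comment> \<open>At \<open>k = 3 ^ n\<close> the carry is 1 and the digits have wrapped to 0,
    which ends the loop and leaves the vector ready for another sweep.\<close>
  define J where "J = (\<lambda>k r' m'. r' rIdx = k \<and> r' rIdx3 = 3 * k \<and> r' rCarry = (if k = 3 ^ n then 1 else 0) \<and>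
    idx n (m' aDigits) = (if k = 3 ^ n then 0 else k) \<and> (\<forall>v<n. m' aDigits v < 3) \<and>
    (\<forall>j. j < k \<or> m aTriple j = 3 * j \<longrightarrow> m' aTriple j = 3 * j) \<and>
    frame (sweep c) r m r' m' \<and> Inv k (r' 0) (m' G))"
  let ?tail = "Inc rIdx ;; Inc rIdx3 ;; Inc rIdx3 ;; Inc rIdx3 ;; increment"
  let ?r0 = "r(rIdx := 0, rIdx3 := 0, rCarry := 0)"
  have "runs (While (Equal rCarry rZero) (Store aTriple rIdx rIdx3 ;; c ;; ?tail)) ?r0 m
      ((3 ^ n - 0) * (T + 8 * L + 6 + 1) + 1) (J (3 ^ n))"
  proof (rule runs_While)
    fix k r' m' assume k: "k < 3 ^ n" and J: "J k r' m'"
    have f: "frame (sweep c) r m r' m'" using J by (simp add: J_def)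
    have const': "r' rZero = 0" "consts_ok n L r'"
      using f w cs by (auto simp: frame_def consts_ok_def)
    let ?m = "m'(aTriple := (m' aTriple)(r' rIdx := r' rIdx3))"
    have "runs c r' ?m T (\<lambda>r'' m''. Inv (Suc k) (r'' 0) (m'' G))"
      by (rule step) (use k J f G in \<open>auto simp: J_def frame_def\<close>)
    then have "runs (c ;; ?tail) r' ?m (T + 8 * L + 5) (J (Suc k))"
    proof (rule runs_Seq)
      fix r1 m1 assume 1: "Inv (Suc k) (r1 0) (m1 G)" and f1: "frame c r' ?m r1 m1"
      let ?r1 = "r1(rIdx := Suc k, rIdx3 := Suc (Suc (Suc (3 * k))))"
      have r1: "r1 rIdx = k" "r1 rIdx3 = 3 * k"
        using f1 w J by (auto simp: frame_def J_def)
      have m1: "m1 aDigits = m' aDigits" "m1 aTriple = (m' aTriple)(k := 3 * k)"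
        using f1 w J by (auto simp: frame_def J_def)
      have ok1: "consts_ok n L ?r1" using const' f1 w by (auto simp: frame_def consts_ok_def)
      have dig: "idx n (m1 aDigits) = k" "\<And>v. v < n \<Longrightarrow> m1 aDigits v < 3" using J k m1 by (auto simp: J_def)
      have "runs increment ?r1 m1 (8 * L + 1) (J (Suc k))"
      proof (rule runs_mono[OF runs_increment[OF ok1]])
        fix r2 m2 assume 2: "r2 rCarry \<le> 1 \<and> (\<forall>v<n. m2 aDigits v < 3) \<and>
            idx n (m1 aDigits) + 1 = idx n (m2 aDigits) + r2 rCarry * 3 ^ n"
          and f2: "frame increment ?r1 m1 r2 m2"
        have lt: "idx n (m2 aDigits) < 3 ^ n" using 2 idx_less by blast
        have "r2 rCarry = (if Suc k = 3 ^ n then 1 else 0) \<and>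
          idx n (m2 aDigits) = (if Suc k = 3 ^ n then 0 else Suc k)"
        proof (cases "r2 rCarry = 0")
          case True
          then show ?thesis using 2 dig lt by simp
        next
          case False
          then have "r2 rCarry = 1" using 2 by simp
          then show ?thesis using 2 dig k by simp
        qed
        moreover have "frame (sweep c) r m r2 m2"
          using f f1 f2 by (auto simp: frame_def)
        moreover have "r2 rIdx = Suc k" "r2 rIdx3 = 3 * Suc k" "r2 0 = r1 0" "m2 G = m1 G"
          using f2 G by (auto simp: frame_def)
        moreover have "\<forall>j. j < Suc k \<or> m aTriple j = 3 * j \<longrightarrow> m2 aTriple j = 3 * j"
          using f2 m1 J by (auto simp: frame_def J_def less_Suc_eq)
        ultimately show "J (Suc k) r2 m2" using 1 2 by (simp add: J_def)
      qed (use dig in auto)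
      then show "runs ?tail r1 m1 (T + 8 * L + 5 - T) (J (Suc k))"
        by (simp add: r1 fun_upd_twist)
    qed simp
    moreover have "r' rCarry = 0" using J k by (simp add: J_def)
    ultimately show "holds (Equal rCarry rZero) (r', m') \<and>
        runs (Store aTriple rIdx rIdx3 ;; c ;; ?tail) r' m' (T + 8 * L + 6) (J (Suc k))"
      using const' by (simp add: ac_simps)
  next
    fix r' m' assume J: "J (3 ^ n) r' m'"
    have "r' rZero = 0" using J w cs by (auto simp: frame_def J_def)
    then show "\<not> holds (Equal rCarry rZero) (r', m')" using J by (simp add: J_def)
  next
    have "idx n (m aDigits) = 0" using zero by (simp add: idx_def)
    then show "J 0 ?r0 m" using init zero by (simp add: J_def frame_def)
  qed simp
  then have "runs (While (Equal rCarry rZero) (Store aTriple rIdx rIdx3 ;; c ;; ?tail)) ?r0 m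
      (3 ^ n * (T + 8 * L + 7) + 1) (\<lambda>r' m'. Inv (3 ^ n) (r' 0) (m' G) \<and>
    (\<forall>v<n. m' aDigits v = 0) \<and> (\<forall>j<3 ^ n. m' aTriple j = 3 * j))"
    by (rule runs_mono) (auto simp: J_def dest: idx_eq_0)
  then show ?thesis by (simp add: sweep_def)
qed

subsection \<open>Decoding ternary vectors\<close>

locale encoded_instance =
  fixes I :: "'a rp_instance" and d :: nat and us :: "'a list" and Ss :: "'a set list"
  assumes inst: "rp_sp_instance d I"
    and us: "enumerates us (universe I)"
    and Ss: "enumerates Ss (sets I)"
begin

abbreviation "n \<equiv> length us"
abbreviation "M \<equiv> length Ss"

text \<open>The summand 1 makes \<open>n\<close>, \<open>M\<close> and the size of every set
  strictly smaller than \<open>L\<close>, as \<open>runs_For\<close> asks of loop bounds.\<close>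

definition L :: nat where
  "L = n + M + 1"

definition level :: "(nat \<Rightarrow> nat) \<Rightarrow> nat \<Rightarrow> 'a set" where
  "level t c = (!) us ` {v. v < n \<and> t v = c}"

definition digits :: "(nat \<Rightarrow> nat) \<Rightarrow> bool" where
  "digits t \<longleftrightarrow> (\<forall>v<n. t v < 3)"

definition row :: "(nat \<Rightarrow> nat) \<Rightarrow> 'a set \<Rightarrow> bool" where
  "row s S \<longleftrightarrow> S \<subseteq> universe I \<and> (\<forall>v<n. s v = (if us ! v \<in> S then 1 else 0))"

section \<open>Sets as vectors over the enumerated universe\<close>

lemma universe_eq: "universe I = (!) us ` {..<n}"
proof -
  have "universe I = set us" using us by (simp add: enumerates_def)
  then show ?thesis using nth_image[of n us] by (simp add: lessThan_atLeast0)
qed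

lemma nth_inj: "inj_on ((!) us) {..<n}"
  using us inj_on_nth[of us "{..<n}"] by (simp add: enumerates_def)

lemma nth_in_universe: "v < n \<Longrightarrow> us ! v \<in> universe I"
  by (auto simp: universe_eq)

lemma card_universe: "card (universe I) = n" and card_sets: "card (sets I) = M"
  using us Ss distinct_card[of us] distinct_card[of Ss] by (simp_all add: enumerates_def)

lemma nth_in_level: "v < n \<Longrightarrow> us ! v \<in> level t c \<longleftrightarrow> t v = c"
  unfolding level_def by (subst inj_on_image_mem_iff[OF nth_inj]) auto

lemma level_subset: "level t c \<subseteq> universe I"
  by (auto simp: level_def universe_eq)

lemma universe_eqI:
  assumes "A \<subseteq> universe I" "B \<subseteq> universe I" "\<And>v. v < n \<Longrightarrow> us ! v \<in> A \<longleftrightarrow> us ! v \<in> B"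
  shows "A = B"
proof -
  have "x \<in> A \<longleftrightarrow> x \<in> B" if "x \<in> universe I" for x
  proof -
    have "x \<in> (!) us ` {..<n}" using that by (simp only: universe_eq)
    then obtain v where "v < n" "x = us ! v" by (elim imageE) simp
    then show ?thesis using assms(3) by simp
  qed
  then show ?thesis using assms(1,2) by blast
qed

lemma card_nth: "A \<subseteq> universe I \<Longrightarrow> card {v. v < n \<and> us ! v \<in> A} = card A"
proof -
  assume "A \<subseteq> universe I"
  then have "A = (!) us ` {v. v < n \<and> us ! v \<in> A}" by (auto simp: universe_eq)
  then have "card A = card ((!) us ` {v. v < n \<and> us ! v \<in> A})" by simp
  also have "\<dots> = card {v. v < n \<and> us ! v \<in> A}"
    by (rule card_image) (rule inj_on_subset[OF nth_inj], auto)
  finally show ?thesis by simp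
qed

lemma row_simps:
  assumes "row s S"
  shows "(\<exists>v<n. s v = 1) \<longleftrightarrow> S \<noteq> {}"
    and "(\<forall>v<n. s v = 1 \<longrightarrow> P v) \<longleftrightarrow> (\<forall>v<n. us ! v \<in> S \<longrightarrow> P v)"
    and "card {v. v < n \<and> s v = 1} = card S"
    and "card {v. v < n \<and> s v = 1 \<and> owner I (us ! v) = i} = card {u \<in> S. owner I u = i}"
proof -
  have S: "S \<subseteq> universe I" and s: "v < n \<Longrightarrow> s v = 1 \<longleftrightarrow> us ! v \<in> S" for v
    using assms by (auto simp: row_def)
  show "(\<exists>v<n. s v = 1) \<longleftrightarrow> S \<noteq> {}" using S s by (auto simp: universe_eq)
  show "(\<forall>v<n. s v = 1 \<longrightarrow> P v) \<longleftrightarrow> (\<forall>v<n. us ! v \<in> S \<longrightarrow> P v)" using s by auto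
  have "{v. v < n \<and> s v = 1} = {v. v < n \<and> us ! v \<in> S}" using s by auto
  then show "card {v. v < n \<and> s v = 1} = card S" using card_nth[OF S] by simp
  have "{v. v < n \<and> s v = 1 \<and> owner I (us ! v) = i} = {v. v < n \<and> us ! v \<in> {u \<in> S. owner I u = i}}"
    using s by auto
  then show "card {v. v < n \<and> s v = 1 \<and> owner I (us ! v) = i} = card {u \<in> S. owner I u = i}"
    using card_nth[of "{u \<in> S. owner I u = i}"] S by auto
qed

lemma row_level:
  assumes "row s S"
  shows "(\<forall>v<n. s v = 1 \<longrightarrow> t v = c) \<longleftrightarrow> S \<subseteq> level t c"
    and "(\<exists>i. \<forall>v<n. s v = 1 \<longrightarrow> owner I (us ! v) = i) \<longleftrightarrow> one_owner I S"
proof -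
  have S: "S \<subseteq> universe I" using assms by (simp add: row_def)
  have all: "(\<forall>v<n. us ! v \<in> S \<longrightarrow> P (us ! v)) \<longleftrightarrow> (\<forall>u\<in>S. P u)" for P
    using S by (auto simp: universe_eq)
  have "(\<forall>v<n. s v = 1 \<longrightarrow> t v = c) \<longleftrightarrow> (\<forall>v<n. us ! v \<in> S \<longrightarrow> us ! v \<in> level t c)"
    using row_simps(2)[OF assms] nth_in_level by simp
  then show "(\<forall>v<n. s v = 1 \<longrightarrow> t v = c) \<longleftrightarrow> S \<subseteq> level t c"
    using all[of "\<lambda>u. u \<in> level t c"] by auto
  show "(\<exists>i. \<forall>v<n. s v = 1 \<longrightarrow> owner I (us ! v) = i) \<longleftrightarrow> one_owner I S"
    unfolding row_simps(2)[OF assms] one_owner_def by (intro ex_cong1 all[of "\<lambda>u. owner I u = _"])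
qed

text \<open>Digit 1 keeps the removed elements inside \<open>W\<close>: level 0 is untouched, so the
  same \<open>W\<close> is meant before and after, while every member of \<open>S\<close> lowers the
  value.\<close>

lemma level_rest:
  assumes "row s S" "S \<subseteq> level t 2"
    and q: "\<And>v. v < n \<Longrightarrow> q v = (if s v = 1 \<and> t v = 2 then 1 else t v)"
  shows "level q 2 = level t 2 - S" "level q 0 = level t 0"
    "digits t \<Longrightarrow> digits q" "S \<noteq> {} \<Longrightarrow> idx n q < idx n t"
proof -
  have s: "v < n \<Longrightarrow> s v = 1 \<longleftrightarrow> us ! v \<in> S" for v using assms(1) by (auto simp: row_def)
  show "level q 2 = level t 2 - S"
    by (rule universe_eqI) (use level_subset in \<open>auto simp: nth_in_level q s[unfolded One_nat_def]\<close>)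
  show "level q 0 = level t 0"
    by (rule universe_eqI) (use level_subset in \<open>auto simp: nth_in_level q\<close>)
  show "digits q" if "digits t" using that q by (auto simp: digits_def)
  show "idx n q < idx n t" if "S \<noteq> {}"
  proof -
    from that have "\<exists>v<n. s v = 1" unfolding row_simps(1)[OF assms(1)] .
    then obtain v where v: "v < n" "s v = 1" by (elim exE conjE)
    have "\<forall>v<n. s v = 1 \<longrightarrow> t v = 2" unfolding row_level(1)[OF assms(1)] by (rule assms(2))
    then have "t v = 2" using v by simp
    then show ?thesis using v q by (intro idx_strict_mono[of _ _ _ v]) auto
  qed
qed

definition covered :: "(nat \<Rightarrow> nat) \<Rightarrow> 'a set" where
  "covered t = universe I - level t 0"

text \<open>The part of the state that neither sweep alters. Five header cells and \<open>n\<close>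
  owners precede the incidence matrix, hence the offset \<open>5 + n\<close>.\<close>

definition env :: "regs \<Rightarrow> arrs \<Rightarrow> bool" where
  "env r m \<longleftrightarrow> consts_ok n L r \<and> r rM = M \<and> r rRows = 5 + n \<and> (\<forall>v<n. m aOwner v = owner I (us ! v)) \<and>
     (\<forall>j<M. \<forall>v<n. m 0 (5 + n + j * n + v) = (if us ! v \<in> Ss ! j then 1 else 0))"

lemma env_frame:
  assumes "env r m" "frame c r m r' m'" "\<forall>x\<in>{rN, rM, rZero, rOne, rTwo, rRows}. x \<notin> wregs c"
    "\<forall>a\<in>{0, aOwner}. a \<notin> warrs c"
  shows "env r' m'"
proof -
  have "r' x = r x" if "x \<in> {rN, rM, rZero, rOne, rTwo, rRows}" for x
    using assms(2) bspec[OF assms(3) that] by (simp add: frame_def)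
  moreover have "m' a = m a" if "a \<in> {0, aOwner}" for a
    using assms(2) bspec[OF assms(4) that] by (simp add: frame_def)
  ultimately show ?thesis using assms(1) unfolding env_def consts_ok_def by simp
qed

lemma env_consts: "env r m \<Longrightarrow> consts_ok n L r"
  by (simp add: env_def)

lemma env_owner: "env r m \<Longrightarrow> v < n \<Longrightarrow> m aOwner v = owner I (us ! v)"
  by (simp add: env_def)

lemma Ss_nth: "j < M \<Longrightarrow> Ss ! j \<in> sets I" "j < M \<Longrightarrow> Ss ! j \<subseteq> universe I"
proof -
  assume "j < M"
  then show *: "Ss ! j \<in> sets I" using Ss nth_mem[of j Ss] by (simp add: enumerates_def)
  show "Ss ! j \<subseteq> universe I" by (rule sets_universe[OF inst *])
qed

lemma ex_sets_iff: "(\<exists>S\<in>sets I. P S) \<longleftrightarrow> (\<exists>j<M. P (Ss ! j))"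
proof -
  have "sets I = set Ss" using Ss by (simp add: enumerates_def)
  moreover have "\<not> (\<forall>S\<in>set Ss. \<not> P S) \<longleftrightarrow> \<not> (\<forall>j<M. \<not> P (Ss ! j))"
    unfolding all_set_conv_all_nth ..
  ultimately show ?thesis by simp
qed

lemma env_row:
  assumes "env r m" "j < M" "\<And>v. v < n \<Longrightarrow> s v = m 0 (5 + n + j * n + v)"
  shows "row s (Ss ! j)"
  using assms Ss_nth(2) unfolding row_def env_def by simp


subsection \<open>The table of maximum covers\<close>

text \<open>Digits 0 and 1 are not told apart. Indexing by ternary vectors all the same allows the
  vector left by \<open>subtract\<close>, with 1 at the removed places, to be looked up as it
  is.\<close>

definition cover_val :: "(nat \<Rightarrow> nat) \<Rightarrow> nat" where
  "cover_val t = max_cover (own_sets I) (level t 2)"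

definition cover_table :: "nat \<Rightarrow> (nat \<Rightarrow> nat) \<Rightarrow> bool" where
  "cover_table k g \<longleftrightarrow> (\<forall>t. digits t \<longrightarrow> idx n t < k \<longrightarrow> g (idx n t) = cover_val t)"

text \<open>Sets that may not be chosen get 0, the value of the empty packing, and so never affect
  the maximum.\<close>

definition cover_row_val :: "(nat \<Rightarrow> nat) \<Rightarrow> nat \<Rightarrow> nat" where
  "cover_row_val t j = (let S = Ss ! j in
     if S \<noteq> {} \<and> S \<subseteq> level t 2 \<and> one_owner I S
     then card S + max_cover (own_sets I) (level t 2 - S) else 0)"

end

text \<open>No instruction adds two registers, so the size of the set is added by
  \<open>rCnt\<close> increments.\<close>

definition add_cover :: com where
  "add_cover = horner aRest ;; Load rX aCover rH ;; For rV rCnt (Inc rX) ;;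
     Cond (Less rAcc rX) (Copy rAcc rX) skip"

definition cover_row :: com where
  "cover_row = copy_row aSet ;; subtract ;; check_owner ;; Cond (Equal rOk rOne) add_cover skip"

definition cover_body :: com where
  "cover_body = Const rAcc 0 ;; Copy rPtr rRows ;; For rRow rM cover_row ;; Store aCover rIdx rAcc"

lemma writes_cover [simp]:
  "wregs add_cover = {rV, rX, rH, rW, rAcc}" "warrs add_cover = {}"
  "wregs cover_row = {rV, rX, rY, rH, rW, rAcc, rOk, rCnt, rOwner, rPtr}" "warrs cover_row = {aSet, aRest}"
  "wregs cover_body = {rV, rX, rY, rH, rW, rAcc, rOk, rCnt, rOwner, rPtr, rRow}"
  "warrs cover_body = {aSet, aRest, aCover}"
  unfolding add_cover_def cover_row_def cover_body_def by auto

lemma runs_add_cover: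
  assumes "consts_ok n L r" "\<And>v. v < n \<Longrightarrow> m aRest v < 3" "r rCnt < L"
    and "\<And>j. j \<le> idx n (m aRest) \<Longrightarrow> m aTriple j = 3 * j"
  shows "runs add_cover r m (12 * L + 5)
    (\<lambda>r' m'. r' rAcc = max (r rAcc) (r rCnt + m aCover (idx n (m aRest))))"
proof -
  define Q where "Q = (\<lambda>(r' :: regs) (m' :: arrs). r' rAcc = max (r rAcc) (r rCnt + m aCover (idx n (m aRest))))"
  let ?c2 = "Cond (Less rAcc rX) (Copy rAcc rX) skip"
  have "runs add_cover r m (12 * L + 5) Q"
    unfolding add_cover_def
  proof (rule runs_Seq[OF runs_horner[OF assms(1,2,4)]])
    fix r1 m1 assume 1: "r1 rH = idx n (m aRest)" and f1: "frame (horner aRest) r m r1 m1"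
    let ?r = "r1(rX := m1 aCover (r1 rH))"
    have "runs (For rV rCnt (Inc rX)) ?r m1 ((1 + 2) * L) ((\<lambda>k r' m'. r' rX = m aCover (idx n (m aRest)) + k) (?r rCnt))"
      by (rule runs_For) (use f1 assms(3) 1 in \<open>auto simp: frame_def\<close>)
    then have "runs (For rV rCnt (Inc rX) ;; ?c2) ?r m1 (3 * L + 2) Q"
      by (rule runs_Seq) (use f1 in \<open>auto simp: frame_def Q_def\<close>)
    then show "runs (Load rX aCover rH ;; For rV rCnt (Inc rX) ;; ?c2) r1 m1 (12 * L + 5 - (9 * L + 2)) Q"
      by simp
  qed simp_all
  then show ?thesis unfolding Q_def .
qed

context encoded_instance
begin

text \<open>The table is assumed right only below the current index. The lookup stays there because
  removing a nonempty set lowers the index strictly.\<close>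

lemma runs_cover_row:
  assumes e: "env r m" and j: "j < M" "r rPtr = 5 + n + j * n"
    and t: "digits (m aDigits)"
    and tr: "\<And>j. j \<le> idx n (m aDigits) \<Longrightarrow> m aTriple j = 3 * j"
    and tab: "cover_table (idx n (m aDigits)) (m aCover)"
  shows "runs cover_row r m (34 * L + 12) (\<lambda>r' m'. r' rPtr = 5 + n + Suc j * n \<and>
    r' rAcc = max (r rAcc) (cover_row_val (m aDigits) j))"
proof -
  let ?t = "m aDigits"
  let ?S = "Ss ! j"
  define Q where "Q = (\<lambda>(r' :: regs) (m' :: arrs). r' rPtr = 5 + n + Suc j * n \<and>
    r' rAcc = max (r rAcc) (cover_row_val (m aDigits) j))"
  let ?c3 = "Cond (Equal rOk rOne) add_cover skip"
  have "runs cover_row r m (34 * L + 12) Q"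
    unfolding cover_row_def
  proof (rule runs_Seq[OF runs_copy_row[OF env_consts[OF e]]])
    fix r1 m1 assume 1: "r1 rPtr = r rPtr + n \<and> (\<forall>v<n. m1 aSet v = m 0 (r rPtr + v))"
      and f1: "frame (copy_row aSet) r m r1 m1"
    have e1: "env r1 m1" by (rule env_frame[OF e f1]) auto
    have row: "row (m1 aSet) ?S" by (rule env_row[OF e j(1)]) (use 1 j(2) in auto)
    have t1: "m1 aDigits = ?t" "m1 aCover = m aCover" "m1 aTriple = m aTriple" using f1 by (auto simp: frame_def)
    have "runs (subtract ;; check_owner ;; ?c3) r1 m1 (29 * L + 12) Q"
    proof (rule runs_Seq[OF runs_subtract[OF env_consts[OF e1]]])
      fix r2 m2 assume 2: "r2 rCnt = card {v. v < n \<and> m1 aSet v = 1} \<and>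
        r2 rOk = (if (\<exists>v<n. m1 aSet v = 1) \<and> (\<forall>v<n. m1 aSet v = 1 \<longrightarrow> m1 aDigits v = 2) then 1 else 0) \<and>
        (\<forall>v<n. m2 aRest v = (if m1 aSet v = 1 \<and> m1 aDigits v = 2 then 1 else m1 aDigits v))"
        and f2: "frame subtract r1 m1 r2 m2"
      have e2: "env r2 m2" by (rule env_frame[OF e1 f2]) auto
      have m2: "m2 aSet = m1 aSet" "m2 aCover = m aCover" "m2 aTriple = m aTriple"
        using f2 t1 by (auto simp: frame_def)
      have ok2: "r2 rOk = (if ?S \<noteq> {} \<and> ?S \<subseteq> level ?t 2 then 1 else 0)"
        using 2 row_simps(1)[OF row] row_level(1)[OF row, of ?t 2] t1(1) by simp
      have owner0: "m2 aOwner v \<noteq> 0" if "v < n" for v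
        using env_owner[OF e2 that] owner_range[OF inst nth_in_universe[OF that]] by auto
      have "runs (check_owner ;; ?c3) r2 m2 (20 * L + 8) Q"
      proof (rule runs_Seq[OF runs_check_owner[OF env_consts[OF e2]]])
        fix r3 m3 assume 3: "r3 rOk = (if r2 rOk = 1 \<and> (\<exists>i. \<forall>v<n. m2 aSet v = 1 \<longrightarrow> m2 aOwner v = i) then 1 else 0)"
          and f3: "frame check_owner r2 m2 r3 m3"
        have "(\<exists>i. \<forall>v<n. m2 aSet v = 1 \<longrightarrow> m2 aOwner v = i) \<longleftrightarrow> one_owner I ?S"
          using row_level(2)[OF row] env_owner[OF e2] m2(1) by simp
        then have ok3: "r3 rOk = (if ?S \<noteq> {} \<and> ?S \<subseteq> level ?t 2 \<and> one_owner I ?S then 1 else 0)"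
          using 3 ok2 by simp
        have e3: "env r3 m3" by (rule env_frame[OF e2 f3]) auto
        have m3: "m3 = m2" using f3 by (auto simp: frame_def)
        have ptr: "r3 rPtr = 5 + n + Suc j * n" "r3 rAcc = r rAcc"
          using f3 f2 f1 1 j(2) by (auto simp: frame_def)
        have one: "r3 rOne = 1" using e3 by (simp add: env_def consts_ok_def)
        show "runs ?c3 r3 m3 (20 * L + 8 - (8 * L + 1)) Q"
        proof (cases "?S \<noteq> {} \<and> ?S \<subseteq> level ?t 2 \<and> one_owner I ?S")
          case True
          have q: "v < n \<Longrightarrow> m2 aRest v = (if m1 aSet v = 1 \<and> ?t v = 2 then 1 else ?t v)" for v
            using 2 t1 by simp
          have "?S \<subseteq> level ?t 2" using True by blast
          note rest = level_rest[OF row this q]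
          have lt: "idx n (m2 aRest) < idx n ?t" "digits (m2 aRest)" using rest(3,4) True t by auto
          then have val: "m2 aCover (idx n (m2 aRest)) = max_cover (own_sets I) (level ?t 2 - ?S)"
            using tab rest(1) by (simp add: cover_table_def cover_val_def m2)
          have cnt: "r3 rCnt = card ?S" using 2 f3 row_simps(3)[OF row] by (simp add: frame_def)
          have "card ?S \<le> n"
            using card_mono[OF finite_universe[OF inst] Ss_nth(2)[OF j(1)]] card_universe by simp
          then have "r3 rCnt < L" using cnt by (simp add: L_def)
          have "runs add_cover r3 m3 (12 * L + 5)
              (\<lambda>r' m'. r' rAcc = max (r3 rAcc) (r3 rCnt + m3 aCover (idx n (m3 aRest))))"
            by (rule runs_add_cover[OF env_consts[OF e3] _ \<open>r3 rCnt < L\<close>])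
              (use lt m3 m2 tr in \<open>auto simp: digits_def\<close>)
          then have "runs add_cover r3 m3 (12 * L + 6) Q"
          proof (rule runs_mono)
            fix r4 m4 assume "r4 rAcc = max (r3 rAcc) (r3 rCnt + m3 aCover (idx n (m3 aRest)))"
              and "frame add_cover r3 m3 r4 m4"
            then show "Q r4 m4" using ptr cnt val m3 True
              by (simp add: Q_def frame_def cover_row_val_def Let_def)
          qed simp
          then show ?thesis using ok3 True one by (simp add: add.commute)
        next
          case False
          then have "Q (r3(rX := r3 rX)) m3" using ptr by (auto simp: Q_def cover_row_val_def Let_def)
          moreover have "r3 rOk = 0" unfolding ok3 using False by (rule if_not_P)
          ultimately show ?thesis using one by simp
        qed
      qed (use ok2 owner0 in auto)
      then show "runs (check_owner ;; ?c3) r2 m2 (29 * L + 12 - (9 * L + 4)) Q" by (rule runs_le) simp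
    qed simp
    then show "runs (subtract ;; check_owner ;; ?c3) r1 m1 (34 * L + 12 - 5 * L) Q" by (rule runs_le) simp
  qed simp_all
  then show ?thesis unfolding Q_def .
qed

text \<open>The maximum over the rows, again by thresholds; \<open>x = 0\<close> stands for the
  empty packing and avoids a maximum over no rows.\<close>

lemma cover_val_rows:
  "x \<le> cover_val t \<longleftrightarrow> x = 0 \<or> (\<exists>j<M. x \<le> cover_row_val t j)"
proof -
  have fin: "finite (level t 2)" using finite_subset[OF level_subset finite_universe[OF inst]] .
  have "x \<le> cover_val t \<longleftrightarrow> x = 0 \<or> (\<exists>S\<in>sets I. one_owner I S \<and> S \<noteq> {} \<and> S \<subseteq> level t 2 \<and>
      x \<le> card S + max_cover (own_sets I) (level t 2 - S))"
    unfolding cover_val_def by (subst max_cover_step[OF fin]) (auto simp: own_sets_def)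
  also have "\<dots> \<longleftrightarrow> x = 0 \<or> (\<exists>j<M. x \<le> cover_row_val t j)"
    unfolding ex_sets_iff cover_row_val_def Let_def by auto
  finally show ?thesis .
qed

lemma runs_cover_body:
  assumes e: "env r m" and t: "digits (m aDigits)" "r rIdx = idx n (m aDigits)"
    and tr: "\<And>j. j \<le> idx n (m aDigits) \<Longrightarrow> m aTriple j = 3 * j"
    and tab: "cover_table (idx n (m aDigits)) (m aCover)"
  shows "runs cover_body r m ((34 * L + 14) * L + 3)
    (\<lambda>r' m'. cover_table (Suc (idx n (m aDigits))) (m' aCover))"
proof -
  let ?t = "m aDigits"
  let ?r = "r(rAcc := 0, rPtr := r rRows)"
  let ?I = "\<lambda>k (r' :: regs) (m' :: arrs). r' rPtr = 5 + n + k * n \<and>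
    (\<forall>x. x \<le> r' rAcc \<longleftrightarrow> x = 0 \<or> (\<exists>j<k. x \<le> cover_row_val ?t j))"
  define Q where "Q = (\<lambda>(r' :: regs) m'. cover_table (Suc (idx n (m aDigits))) (m' aCover))"
  have M: "r rM = M" "r rRows = 5 + n" using e by (auto simp: env_def)
  have "runs (For rRow rM cover_row) ?r m ((34 * L + 12 + 2) * L) (?I (?r rM))"
  proof (rule runs_For)
    fix k r' m' assume k: "k < ?r rM" "r' rRow = k" and Ik: "?I k r' m'"
      and f: "frame (For rRow rM cover_row) ?r m r' m'"
    have "env ?r m" using e by (simp add: env_def consts_ok_def)
    then have e': "env r' m'" by (rule env_frame[OF _ f]) auto
    have m': "m' aDigits = ?t" "m' aTriple = m aTriple" "m' aCover = m aCover"
      using f by (auto simp: frame_def)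
    have "runs cover_row r' m' (34 * L + 12) (\<lambda>r'' m''. r'' rPtr = 5 + n + Suc k * n \<and>
        r'' rAcc = max (r' rAcc) (cover_row_val (m' aDigits) k))"
      by (rule runs_cover_row) (use e' k M Ik m' t tr tab in auto)
    then show "runs cover_row r' m' (34 * L + 12) (\<lambda>r'' m''. ?I (Suc k) (r''(rRow := Suc k)) m'')"
      by (rule runs_mono) (use Ik m' in \<open>auto simp: less_Suc_eq le_max_iff_disj\<close>)
  qed (use M in \<open>auto simp: L_def\<close>)
  then have "runs (For rRow rM cover_row ;; Store aCover rIdx rAcc) ?r m ((34 * L + 14) * L + 1) Q"
  proof (rule runs_Seq)
    fix r' m' assume I': "?I (?r rM) r' m'" and f: "frame (For rRow rM cover_row) ?r m r' m'"
    have "x \<le> r' rAcc \<longleftrightarrow> x \<le> cover_val ?t" for x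
      using I' M cover_val_rows[of x ?t] by simp
    \<comment> \<open>Two numbers with the same lower bounds are equal: each is tested against the
      other.\<close>
    from this[of "r' rAcc"] this[of "cover_val ?t"] have acc: "r' rAcc = cover_val ?t" by simp
    have m': "m' aCover = m aCover" "r' rIdx = idx n ?t" using f t by (auto simp: frame_def)
    have "cover_table (Suc (idx n ?t)) ((m aCover)(idx n ?t := cover_val ?t))"
      unfolding cover_table_def
    proof (intro allI impI)
      fix t' assume t': "digits t'" "idx n t' < Suc (idx n ?t)"
      show "((m aCover)(idx n ?t := cover_val ?t)) (idx n t') = cover_val t'"
      proof (cases "idx n t' = idx n ?t")
        case True
        \<comment> \<open>Equal indices only give agreement below \<open>n\<close>, but
          \<open>level\<close> looks at no other places.\<close>
        have "t' v = ?t v" if "v < n" for v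
          using idx_eqD[OF True _ _ that] t'(1) t(1) by (auto simp: digits_def)
        then have "level t' 2 = level ?t 2" unfolding level_def by (intro arg_cong[of _ _ "(`) _"]) auto
        then show ?thesis using True by (simp add: cover_val_def)
      next
        case False
        then show ?thesis using tab t' unfolding cover_table_def by auto
      qed
    qed
    then show "runs (Store aCover rIdx rAcc) r' m' ((34 * L + 14) * L + 1 - (34 * L + 12 + 2) * L) Q"
      using m' acc by (simp add: Q_def add.commute)
  qed (simp add: add.commute)
  then have "runs cover_body r m ((34 * L + 14) * L + 3) Q" unfolding cover_body_def by simp
  then show ?thesis unfolding Q_def .
qed

end

subsection \<open>The table of feasible partial partitions\<close>

text \<open>Clearing \<open>aSet\<close> turns it into the row of the empty set, so the first
  \<open>check_stable\<close> in \<open>feas_body\<close> decides whether somebody gains without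
  rejecting anything.\<close>

definition count_digits :: com where
  "count_digits = Const rOnes 0 ;; Const rTwos 0 ;;
     For rV rN (Load rX aDigits rV ;; Cond (Equal rX rOne) (Inc rOnes) skip ;;
       Cond (Equal rX rTwo) (Inc rTwos) skip ;; Store aSet rV rZero)"

definition add_feas :: com where
  "add_feas = horner aRest ;; Load rX aFeas rH ;; Cond (Equal rX rOne) (Const rAcc 1) skip"

definition feas_row :: com where
  "feas_row = copy_row aSet ;; subtract ;; check_stable ;; Cond (Equal rOk rOne) add_feas skip"

text \<open>No digit 1 means \<open>Y = W\<close>: only then does the entry describe a whole packing
  rather than a part of one.\<close>

definition finish :: com where
  "finish = Store aFeas rIdx rAcc ;;
     Cond (Equal rAcc rOne) (Cond (Equal rOnes rZero) (Cond (Less rTwos rTarget) skip (Const 0 1)) skip) skip"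

text \<open>\<open>rAcc\<close> starts with the base case of the recursion: 1 iff \<open>Y\<close>
  is empty and nobody gains by rejecting nothing.\<close>

definition feas_body :: com where
  "feas_body = count_digits ;; Const rAcc 0 ;; Const rOk 1 ;; check_stable ;;
     Cond (Equal rTwos rZero) (Copy rAcc rOk) skip ;;
     Copy rPtr rRows ;; For rRow rM feas_row ;; finish"

lemma writes_feas [simp]:
  "wregs count_digits = {rOnes, rTwos, rV, rX}" "warrs count_digits = {aSet}"
  "wregs add_feas = {rV, rX, rH, rW, rAcc}" "warrs add_feas = {}"
  "wregs feas_row = {rV, rX, rY, rH, rW, rAcc, rOk, rCnt, rPtr, rU, rAgent, rCntA}"
  "warrs feas_row = {aSet, aRest, aRegion}"
  "wregs finish = {0, rX}" "warrs finish = {aFeas}"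
  "wregs feas_body = {0, rV, rX, rY, rH, rW, rAcc, rOk, rCnt, rPtr, rU, rAgent, rCntA, rRow, rOnes, rTwos}"
  "warrs feas_body = {aSet, aRest, aRegion, aFeas}"
  unfolding count_digits_def add_feas_def feas_row_def finish_def feas_body_def by auto

lemma runs_count_digits:
  assumes "consts_ok n L r"
  shows "runs count_digits r m (8 * L + 2) (\<lambda>r' m'. (r' rOnes = 0 \<longleftrightarrow> (\<forall>v<n. m aDigits v \<noteq> 1)) \<and>
    r' rTwos = card {v. v < n \<and> m aDigits v = 2} \<and> (\<forall>v<n. m' aSet v = 0))"
proof -
  have c: "r rN = n" "n < L" "r rOne = 1" "r rTwo = 2" "r rZero = 0" using assms by (auto simp: consts_ok_def)
  let ?r = "r(rOnes := 0, rTwos := 0)"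
  let ?I = "\<lambda>k (r' :: regs) (m' :: arrs). (r' rOnes = 0 \<longleftrightarrow> (\<forall>v<k. m aDigits v \<noteq> 1)) \<and>
    r' rTwos = card {v. v < k \<and> m aDigits v = 2} \<and> (\<forall>v<k. m' aSet v = 0)"
  let ?c = "Load rX aDigits rV ;; Cond (Equal rX rOne) (Inc rOnes) skip ;;
       Cond (Equal rX rTwo) (Inc rTwos) skip ;; Store aSet rV rZero"
  have "runs (For rV rN ?c) ?r m ((6 + 2) * L) (?I (?r rN))"
  proof (rule runs_For)
    fix k r' m'
    assume k: "k < ?r rN" "r' rV = k" and I: "?I k r' m'" and f: "frame (For rV rN ?c) ?r m r' m'"
    have cs: "r' rOne = 1" "r' rTwo = 2" "r' rZero = 0" using f c by (auto simp: frame_def)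
    have ma: "m' aDigits = m aDigits" using f by (auto simp: frame_def)
    have s: "{v. v < Suc k \<and> m aDigits v = 2} =
        (if m aDigits k = 2 then insert k {v. v < k \<and> m aDigits v = 2} else {v. v < k \<and> m aDigits v = 2})"
      by (auto simp: less_Suc_eq)
    then have card: "card {v. v < Suc k \<and> m aDigits v = 2} =
        (if m aDigits k = 2 then Suc (card {v. v < k \<and> m aDigits v = 2}) else card {v. v < k \<and> m aDigits v = 2})"
      by simp
    show "runs ?c r' m' 6 (\<lambda>r'' m''. ?I (Suc k) (r''(rV := Suc k)) m'')"
      using I cs k ma card by (auto simp: less_Suc_eq)
  qed (use c in \<open>auto simp: frame_def\<close>)
  then show ?thesis using c by (simp add: count_digits_def)
qed

lemma runs_add_feas:
  assumes "consts_ok n L r" "\<And>v. v < n \<Longrightarrow> m aRest v < 3"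
    and "\<And>j. j \<le> idx n (m aRest) \<Longrightarrow> m aTriple j = 3 * j"
  shows "runs add_feas r m (9 * L + 5)
    (\<lambda>r' m'. r' rAcc = (if m aFeas (idx n (m aRest)) = 1 then 1 else r rAcc))"
proof -
  define Q where "Q = (\<lambda>(r' :: regs) (m' :: arrs). r' rAcc = (if m aFeas (idx n (m aRest)) = 1 then 1 else r rAcc))"
  have "runs add_feas r m (9 * L + 5) Q"
    unfolding add_feas_def
  proof (rule runs_Seq[OF runs_horner[OF assms]])
    fix r1 m1 assume 1: "r1 rH = idx n (m aRest)" and f1: "frame (horner aRest) r m r1 m1"
    have one: "r1 rOne = 1" "r1 rAcc = r rAcc" "m1 aFeas = m aFeas" using f1 assms(1) by (auto simp: frame_def consts_ok_def)
    show "runs (Load rX aFeas rH ;; Cond (Equal rX rOne) (Const rAcc 1) skip) r1 m1 (9 * L + 5 - (9 * L + 2)) Q"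
      using 1 one by (simp add: Q_def)
  qed simp_all
  then show ?thesis unfolding Q_def .
qed

context encoded_instance
begin

section \<open>Feasible pairs as table entries\<close>

definition feas :: "(nat \<Rightarrow> nat) \<Rightarrow> bool" where
  "feas t \<longleftrightarrow> feasible I (covered t) (level t 2)"

definition feas_table :: "nat \<Rightarrow> (nat \<Rightarrow> nat) \<Rightarrow> bool" where
  "feas_table k g \<longleftrightarrow> (\<forall>t. digits t \<longrightarrow> idx n t < k \<longrightarrow> g (idx n t) = (if feas t then 1 else 0))"

text \<open>\<open>nat\<close> sends a negative target to 0, a bound that is met by every set, just
  like the original one.\<close>

definition solution :: "(nat \<Rightarrow> nat) \<Rightarrow> bool" where
  "solution t \<longleftrightarrow> digits t \<and> (\<forall>v<n. t v \<noteq> 1) \<and> feas t \<and> nat (target I) \<le> card (level t 2)"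

definition feas_inv :: "nat \<Rightarrow> nat \<Rightarrow> (nat \<Rightarrow> nat) \<Rightarrow> bool" where
  "feas_inv k a g \<longleftrightarrow> feas_table k g \<and> a = (if \<exists>t. idx n t < k \<and> solution t then 1 else 0)"

definition feas_row_val :: "(nat \<Rightarrow> nat) \<Rightarrow> nat \<Rightarrow> bool" where
  "feas_row_val t j \<longleftrightarrow> Ss ! j \<noteq> {} \<and> Ss ! j \<subseteq> level t 2 \<and> stable I (covered t) (Ss ! j) \<and>
     feasible I (covered t) (level t 2 - Ss ! j)"

lemma level_region:
  assumes "row (m aSet) S" "\<And>v. v < n \<Longrightarrow> m aOwner v = owner I (us ! v)"
  shows "level (region_digits m i) 2 = region I i (covered (m aDigits)) S"
proof (rule universe_eqI)
  show "region I i (covered (m aDigits)) S \<subseteq> universe I" by (auto simp: region_def)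
  fix v assume v: "v < n"
  have "m aSet v = 1 \<longleftrightarrow> us ! v \<in> S" using assms(1) v by (simp add: row_def)
  moreover have "us ! v \<notin> covered (m aDigits) \<longleftrightarrow> m aDigits v = 0"
    using v nth_in_universe nth_in_level by (simp add: covered_def)
  ultimately show "us ! v \<in> level (region_digits m i) 2 \<longleftrightarrow> us ! v \<in> region I i (covered (m aDigits)) S"
    using nth_in_level[OF v] nth_in_universe[OF v] assms(2)[OF v]
    by (simp add: region_digits_def region_def)
qed (rule level_subset)

lemma runs_check_stable_instance:
  assumes e: "env r m" and ok: "r rOk \<le> 1" and row: "row (m aSet) S"
    and tr: "\<And>j. j < 3 ^ n \<Longrightarrow> m aTriple j = 3 * j" and tab: "cover_table (3 ^ n) (m aCover)"
  shows "runs check_stable r m ((20 * L + 9) * L)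
    (\<lambda>r' m'. r' rOk = (if r rOk = 1 \<and> stable I (covered (m aDigits)) S then 1 else 0))"
proof -
  have own: "v < n \<Longrightarrow> m aOwner v = owner I (us ! v)" for v by (rule env_owner[OF e])
  have P: "m aCover (idx n (region_digits m (m aOwner u)))
       \<le> card {v. v < n \<and> m aSet v = 1 \<and> m aOwner v = m aOwner u} \<longleftrightarrow>
     max_cover (own_sets I) (region I (owner I (us ! u)) (covered (m aDigits)) S)
       \<le> card {v \<in> S. owner I v = owner I (us ! u)}" if u: "u < n" for u
  proof -
    let ?q = "region_digits m (m aOwner u)"
    have d: "digits ?q" by (simp add: digits_def region_digits_def)
    then have "idx n ?q < 3 ^ n" using idx_less by (simp add: digits_def)
    then have "m aCover (idx n ?q) = max_cover (own_sets I) (level ?q 2)"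
      using tab d by (simp add: cover_table_def cover_val_def)
    also have "level ?q 2 = region I (owner I (us ! u)) (covered (m aDigits)) S"
      using level_region[OF row own] own[OF u] by simp
    finally have 1: "m aCover (idx n ?q) =
      max_cover (own_sets I) (region I (owner I (us ! u)) (covered (m aDigits)) S)" .
    have "{v. v < n \<and> m aSet v = 1 \<and> m aOwner v = m aOwner u} =
        {v. v < n \<and> m aSet v = 1 \<and> owner I (us ! v) = owner I (us ! u)}"
      using own u by auto
    then have 2: "card {v. v < n \<and> m aSet v = 1 \<and> m aOwner v = m aOwner u} = card {v \<in> S. owner I v = owner I (us ! u)}"
      using row_simps(4)[OF row] by simp
    show ?thesis unfolding 1 2 ..
  qed
  have ball: "(\<forall>u\<in>(!) us ` {..<n}. R u) \<longleftrightarrow> (\<forall>u<n. R (us ! u))" for R by auto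
  have "(\<forall>u<n. m aCover (idx n (region_digits m (m aOwner u)))
       \<le> card {v. v < n \<and> m aSet v = 1 \<and> m aOwner v = m aOwner u}) \<longleftrightarrow> stable I (covered (m aDigits)) S"
    unfolding stable_def universe_eq ball using P by simp
  then show ?thesis using runs_check_stable[where m = m, OF env_consts[OF e] ok tr] by simp
qed

lemma runs_feas_row:
  assumes e: "env r m" and j: "j < M" "r rPtr = 5 + n + j * n"
    and t: "digits (m aDigits)"
    and tr: "\<And>j. j < 3 ^ n \<Longrightarrow> m aTriple j = 3 * j"
    and tabc: "cover_table (3 ^ n) (m aCover)"
    and tab: "feas_table (idx n (m aDigits)) (m aFeas)"
  shows "runs feas_row r m ((20 * L + 9) * L + (23 * L + 10)) (\<lambda>r' m'. r' rPtr = 5 + n + Suc j * n \<and>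
    r' rAcc = (if feas_row_val (m aDigits) j then 1 else r rAcc))"
proof -
  let ?t = "m aDigits"
  let ?S = "Ss ! j"
  define Q where "Q = (\<lambda>(r' :: regs) (m' :: arrs). r' rPtr = 5 + n + Suc j * n \<and>
    r' rAcc = (if feas_row_val (m aDigits) j then 1 else r rAcc))"
  \<comment> \<open>Hides the quadratic term, so that the remaining time bounds are linear in
    \<open>B\<close> and \<open>L\<close>.\<close>
  define B where "B = (20 * L + 9) * L"
  let ?c3 = "Cond (Equal rOk rOne) add_feas skip"
  have "runs feas_row r m (B + (23 * L + 10)) Q"
    unfolding feas_row_def
  proof (rule runs_Seq[OF runs_copy_row[OF env_consts[OF e]]])
    fix r1 m1 assume 1: "r1 rPtr = r rPtr + n \<and> (\<forall>v<n. m1 aSet v = m 0 (r rPtr + v))"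
      and f1: "frame (copy_row aSet) r m r1 m1"
    have e1: "env r1 m1" by (rule env_frame[OF e f1]) auto
    have row: "row (m1 aSet) ?S" by (rule env_row[OF e j(1)]) (use 1 j(2) in auto)
    have t1: "m1 aDigits = ?t" "m1 aCover = m aCover" "m1 aTriple = m aTriple" "m1 aFeas = m aFeas"
      using f1 by (auto simp: frame_def)
    have "runs (subtract ;; check_stable ;; ?c3) r1 m1 (B + (18 * L + 10)) Q"
    proof (rule runs_Seq[OF runs_subtract[OF env_consts[OF e1]]])
      fix r2 m2 assume 2: "r2 rCnt = card {v. v < n \<and> m1 aSet v = 1} \<and>
        r2 rOk = (if (\<exists>v<n. m1 aSet v = 1) \<and> (\<forall>v<n. m1 aSet v = 1 \<longrightarrow> m1 aDigits v = 2) then 1 else 0) \<and>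
        (\<forall>v<n. m2 aRest v = (if m1 aSet v = 1 \<and> m1 aDigits v = 2 then 1 else m1 aDigits v))"
        and f2: "frame subtract r1 m1 r2 m2"
      have e2: "env r2 m2" by (rule env_frame[OF e1 f2]) auto
      have m2: "m2 aSet = m1 aSet" "m2 aCover = m aCover" "m2 aTriple = m aTriple" "m2 aFeas = m aFeas"
        "m2 aDigits = ?t"
        using f2 t1 by (auto simp: frame_def)
      have ok2: "r2 rOk = (if ?S \<noteq> {} \<and> ?S \<subseteq> level ?t 2 then 1 else 0)"
        using 2 row_simps(1)[OF row] row_level(1)[OF row, of ?t 2] t1(1) by simp
      have row2: "row (m2 aSet) ?S" using row m2 by simp
      have stab: "runs check_stable r2 m2 B
        (\<lambda>r' m'. r' rOk = (if r2 rOk = 1 \<and> stable I (covered (m2 aDigits)) ?S then 1 else 0))"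
        unfolding B_def
        by (rule runs_check_stable_instance[OF e2 _ row2]) (use ok2 m2 tr tabc in auto)
      have "runs (check_stable ;; ?c3) r2 m2 (B + (9 * L + 6)) Q"
      proof (rule runs_Seq[OF stab])
        fix r3 m3 assume 3: "r3 rOk = (if r2 rOk = 1 \<and> stable I (covered (m2 aDigits)) ?S then 1 else 0)"
          and f3: "frame check_stable r2 m2 r3 m3"
        have ok3: "r3 rOk = (if ?S \<noteq> {} \<and> ?S \<subseteq> level ?t 2 \<and> stable I (covered ?t) ?S then 1 else 0)"
          using 3 ok2 m2 by simp
        have e3: "env r3 m3" by (rule env_frame[OF e2 f3]) auto
        have m3: "m3 aRest = m2 aRest" "m3 aTriple = m aTriple" "m3 aFeas = m aFeas"
          using f3 m2 by (auto simp: frame_def)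
        have ptr: "r3 rPtr = 5 + n + Suc j * n" "r3 rAcc = r rAcc"
          using f3 f2 f1 1 j(2) by (auto simp: frame_def)
        have one: "r3 rOne = 1" using e3 by (simp add: env_def consts_ok_def)
        show "runs ?c3 r3 m3 (B + (9 * L + 6) - B) Q"
        proof (cases "?S \<noteq> {} \<and> ?S \<subseteq> level ?t 2 \<and> stable I (covered ?t) ?S")
          case True
          have q: "v < n \<Longrightarrow> m2 aRest v = (if m1 aSet v = 1 \<and> ?t v = 2 then 1 else ?t v)" for v
            using 2 t1 by simp
          have "?S \<subseteq> level ?t 2" using True by blast
          note rest = level_rest[OF row this q]
          have lt: "idx n (m2 aRest) < idx n ?t" "digits (m2 aRest)" using rest(3,4) True t by auto
          have lt3: "idx n ?t < 3 ^ n" using t idx_less by (simp add: digits_def)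
          \<comment> \<open>Level 0, and with it \<open>covered\<close>, survives the removal: the
            entry looked up speaks about the same \<open>W\<close>.\<close>
          have "feas (m2 aRest) \<longleftrightarrow> feasible I (covered ?t) (level ?t 2 - ?S)"
            using rest(1,2) by (simp add: feas_def covered_def)
          then have val: "m aFeas (idx n (m2 aRest)) = (if feasible I (covered ?t) (level ?t 2 - ?S) then 1 else 0)"
            using tab lt by (simp add: feas_table_def)
          have "runs add_feas r3 m3 (9 * L + 5)
              (\<lambda>r' m'. r' rAcc = (if m3 aFeas (idx n (m3 aRest)) = 1 then 1 else r3 rAcc))"
            by (rule runs_add_feas[OF env_consts[OF e3]])
              (use lt lt3 m3 tr in \<open>auto simp: digits_def\<close>)
          then have "runs add_feas r3 m3 (9 * L + 5) Q"
          proof (rule runs_mono)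
            fix r4 m4 assume 4: "r4 rAcc = (if m3 aFeas (idx n (m3 aRest)) = 1 then 1 else r3 rAcc)"
              and f4: "frame add_feas r3 m3 r4 m4"
            have "r4 rPtr = r3 rPtr" using f4 by (simp add: frame_def)
            moreover have "r4 rAcc = (if feas_row_val ?t j then 1 else r rAcc)"
              using 4 True m3 val ptr by (simp add: feas_row_val_def)
            ultimately show "Q r4 m4" using ptr by (simp add: Q_def)
          qed simp
          then show ?thesis using ok3 True one by (simp add: add.commute)
        next
          case False
          then have "Q (r3(rX := r3 rX)) m3" using ptr by (auto simp: Q_def feas_row_val_def)
          moreover have "r3 rOk = 0" unfolding ok3 using False by (rule if_not_P)
          ultimately show ?thesis using one by simp
        qed
      qed simp
      then show "runs (check_stable ;; ?c3) r2 m2 (B + (18 * L + 10) - (9 * L + 4)) Q" by (rule runs_le) simp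
    qed simp
    then show "runs (subtract ;; check_stable ;; ?c3) r1 m1 (B + (23 * L + 10) - 5 * L) Q" by (rule runs_le) simp
  qed simp_all
  then show ?thesis unfolding Q_def B_def .
qed

lemma feas_rows:
  "feas t \<longleftrightarrow> level t 2 = {} \<and> stable I (covered t) {} \<or> (\<exists>j<M. feas_row_val t j)"
  unfolding feas_def by (subst feasible_step) (simp add: ex_sets_iff feas_row_val_def)

text \<open>Vectors are total functions on the naturals. An index determines their digits below
  \<open>n\<close> only, so one table entry stands for many vectors and must be right for all of
  them.\<close>

lemma feas_cong:
  assumes "idx n t = idx n t'" "digits t" "digits t'"
  shows "feas t \<longleftrightarrow> feas t'" "solution t \<longleftrightarrow> solution t'"
proof -
  have eq: "t v = t' v" if "v < n" for v
    using idx_eqD[OF assms(1) _ _ that] assms(2,3) by (auto simp: digits_def)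
  have "level t c = level t' c" for c
    unfolding level_def by (intro arg_cong[of _ _ "(`) _"]) (use eq in auto)
  then show "feas t \<longleftrightarrow> feas t'" "solution t \<longleftrightarrow> solution t'"
    using eq assms(2,3) by (auto simp: feas_def covered_def solution_def)
qed

lemma feas_inv_Suc:
  assumes t: "digits t" and inv: "feas_inv (idx n t) a g"
  shows "feas_inv (Suc (idx n t)) (if solution t then 1 else a) (g(idx n t := if feas t then 1 else 0))"
proof -
  let ?k = "idx n t"
  have "feas_table (Suc ?k) (g(?k := if feas t then 1 else 0))"
    unfolding feas_table_def
  proof (intro allI impI)
    fix t' assume t': "digits t'" "idx n t' < Suc ?k"
    show "(g(?k := if feas t then 1 else 0)) (idx n t') = (if feas t' then 1 else 0)"
    proof (cases "idx n t' = ?k")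
      case True
      then show ?thesis using feas_cong(1)[OF True t'(1) t] by simp
    next
      case False
      then show ?thesis using inv t' by (simp add: feas_inv_def feas_table_def)
    qed
  qed
  moreover have "(\<exists>t'. idx n t' < Suc ?k \<and> solution t') \<longleftrightarrow> solution t \<or> (\<exists>t'. idx n t' < ?k \<and> solution t')"
  proof
    assume "\<exists>t'. idx n t' < Suc ?k \<and> solution t'"
    then obtain t' where t': "idx n t' < Suc ?k" "solution t'" by blast
    show "solution t \<or> (\<exists>t'. idx n t' < ?k \<and> solution t')"
    proof (cases "idx n t' = ?k")
      case True
      then have "solution t" using feas_cong(2)[OF True _ t] t'(2) by (simp add: solution_def)
      then show ?thesis ..
    next
      case False
      then have "idx n t' < ?k" using t'(1) by simp
      then show ?thesis using t'(2) by blast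
    qed
  next
    assume "solution t \<or> (\<exists>t'. idx n t' < ?k \<and> solution t')"
    then show "\<exists>t'. idx n t' < Suc ?k \<and> solution t'" using less_SucI by blast
  qed
  ultimately show ?thesis using inv by (simp add: feas_inv_def)
qed

lemma runs_finish:
  assumes e: "env r m" and "r rTarget = nat (target I)" "r rIdx = idx n t"
    and t: "digits t" and inv: "feas_inv (idx n t) (r 0) (m aFeas)"
    and acc: "r rAcc = (if feas t then 1 else 0)"
    and ones: "r rOnes = 0 \<longleftrightarrow> (\<forall>v<n. t v \<noteq> 1)" and twos: "r rTwos = card (level t 2)"
  shows "runs finish r m 5 (\<lambda>r' m'. feas_inv (Suc (idx n t)) (r' 0) (m' aFeas))"
proof -
  have cs: "r rOne = 1" "r rZero = 0" using e by (auto simp: env_def consts_ok_def)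
  have sol: "solution t \<longleftrightarrow> r rAcc = 1 \<and> r rOnes = 0 \<and> \<not> r rTwos < r rTarget"
    using assms by (auto simp: solution_def)
  define Q where "Q = (\<lambda>(r' :: regs) (m' :: arrs). feas_inv (Suc (idx n t)) (r' 0) (m' aFeas))"
  have "Q r' m'" if "r' 0 = (if solution t then 1 else r 0)" "m' aFeas = (m aFeas)(idx n t := r rAcc)" for r' m'
    using feas_inv_Suc[OF t inv] that acc by (simp add: Q_def)
  then have "runs finish r m 5 Q"
    unfolding finish_def using cs assms(3) sol by simp
  then show ?thesis unfolding Q_def .
qed

lemma runs_feas_body:
  assumes e: "env r m" and t: "digits (m aDigits)" "r rIdx = idx n (m aDigits)"
    and target: "r rTarget = nat (target I)"
    and tr: "\<And>j. j < 3 ^ n \<Longrightarrow> m aTriple j = 3 * j"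
    and tabc: "cover_table (3 ^ n) (m aCover)"
    and inv: "feas_inv (idx n (m aDigits)) (r 0) (m aFeas)"
  shows "runs feas_body r m (((20 * L + 9) * L + (23 * L + 10) + 2) * L + ((20 * L + 9) * L + (8 * L + 12)))
    (\<lambda>r' m'. feas_inv (Suc (idx n (m aDigits))) (r' 0) (m' aFeas))"
proof -
  let ?t = "m aDigits"
  define Q where "Q = (\<lambda>(r' :: regs) (m' :: arrs). feas_inv (Suc (idx n ?t)) (r' 0) (m' aFeas))"
  define B where "B = (20 * L + 9) * L"
  define D where "D = ((20 * L + 9) * L + (23 * L + 10) + 2) * L"
  let ?c4 = "For rRow rM feas_row ;; finish"
  let ?c3 = "Cond (Equal rTwos rZero) (Copy rAcc rOk) skip ;; Copy rPtr rRows ;; ?c4"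
  let ?c2 = "Const rAcc 0 ;; Const rOk 1 ;; check_stable ;; ?c3"
  have fin: "finite (level ?t 2)" using finite_subset[OF level_subset finite_universe[OF inst]] .
  have "runs feas_body r m (D + (B + (8 * L + 12))) Q"
    unfolding feas_body_def
  proof (rule runs_Seq[OF runs_count_digits[OF env_consts[OF e]]])
    fix r1 m1 assume 1: "(r1 rOnes = 0 \<longleftrightarrow> (\<forall>v<n. ?t v \<noteq> 1)) \<and>
        r1 rTwos = card {v. v < n \<and> ?t v = 2} \<and> (\<forall>v<n. m1 aSet v = 0)"
      and f1: "frame count_digits r m r1 m1"
    let ?r1 = "r1(rAcc := 0, rOk := 1)"
    have "env r1 m1" by (rule env_frame[OF e f1]) auto
    then have e1: "env ?r1 m1" by (simp add: env_def consts_ok_def)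
    have m1: "m1 aDigits = ?t" "m1 aCover = m aCover" "m1 aTriple = m aTriple" "m1 aFeas = m aFeas"
      using f1 by (auto simp: frame_def)
    have row: "row (m1 aSet) {}" using 1 by (simp add: row_def)
    have "{v. v < n \<and> ?t v = 2} = {v. v < n \<and> us ! v \<in> level ?t 2}" using nth_in_level by auto
    then have twos: "r1 rTwos = card (level ?t 2)" using 1 card_nth[OF level_subset, of ?t 2] by simp
    have stab: "runs check_stable ?r1 m1 B
        (\<lambda>r' m'. r' rOk = (if ?r1 rOk = 1 \<and> stable I (covered (m1 aDigits)) {} then 1 else 0))"
      unfolding B_def
      by (rule runs_check_stable_instance[OF e1 _ row]) (use m1 tr tabc in auto)
    have "runs (check_stable ;; ?c3) ?r1 m1 (D + (B + 8)) Q"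
    proof (rule runs_Seq[OF stab])
      fix r2 m2 assume 2: "r2 rOk = (if ?r1 rOk = 1 \<and> stable I (covered (m1 aDigits)) {} then 1 else 0)"
        and f2: "frame check_stable ?r1 m1 r2 m2"
      have ok2: "r2 rOk = (if stable I (covered ?t) {} then 1 else 0)" using 2 m1 by simp
      have e2: "env r2 m2" by (rule env_frame[OF e1 f2]) auto
      have m2: "m2 aDigits = ?t" "m2 aCover = m aCover" "m2 aTriple = m aTriple" "m2 aFeas = m aFeas"
        using f2 m1 by (auto simp: frame_def)
      have r2: "r2 rAcc = 0" "r2 rTwos = card (level ?t 2)" "r2 rZero = 0" "r2 rRows = 5 + n" "r2 rM = M"
        using f2 twos e2 by (auto simp: frame_def env_def consts_ok_def)
      \<comment> \<open>The code after the conditional is verified once, for every \<open>r3\<close>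
        that differs from \<open>r2\<close> at most in \<open>rAcc\<close>, \<open>rPtr\<close> and
        \<open>rX\<close>; both branches are instances.\<close>
      have main: "runs ?c4 r3 m2 (D + 5) Q"
        if r3: "r3 rAcc = (if level ?t 2 = {} \<and> stable I (covered ?t) {} then 1 else 0)" "r3 rPtr = 5 + n"
          "\<And>x. x \<notin> {rAcc, rPtr, rX} \<Longrightarrow> r3 x = r2 x" for r3
      proof -
        have e3: "env r3 m2" using e2 r3(3) by (simp add: env_def consts_ok_def)
        have M3: "r3 rM = M" using e3 by (simp add: env_def)
        let ?I = "\<lambda>k (r' :: regs) (m' :: arrs). r' rPtr = 5 + n + k * n \<and>
          r' rAcc = (if level ?t 2 = {} \<and> stable I (covered ?t) {} \<or> (\<exists>j<k. feas_row_val ?t j) then 1 else 0)"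
        have "runs (For rRow rM feas_row) r3 m2 (((20 * L + 9) * L + (23 * L + 10) + 2) * L) (?I (r3 rM))"
        proof (rule runs_For)
          fix k r' m' assume k: "k < r3 rM" "r' rRow = k" and Ik: "?I k r' m'"
            and f: "frame (For rRow rM feas_row) r3 m2 r' m'"
          have e': "env r' m'" by (rule env_frame[OF e3 f]) auto
          have m': "m' aDigits = ?t" "m' aTriple = m aTriple" "m' aCover = m aCover" "m' aFeas = m aFeas"
            using f m2 by (auto simp: frame_def)
          have "feas_table (idx n ?t) (m aFeas)" using inv by (simp add: feas_inv_def)
          then have "runs feas_row r' m' ((20 * L + 9) * L + (23 * L + 10)) (\<lambda>r'' m''. r'' rPtr = 5 + n + Suc k * n \<and>
              r'' rAcc = (if feas_row_val (m' aDigits) k then 1 else r' rAcc))"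
            by (intro runs_feas_row) (use e' k M3 Ik m' t tr tabc in auto)
          then show "runs feas_row r' m' ((20 * L + 9) * L + (23 * L + 10)) (\<lambda>r'' m''. ?I (Suc k) (r''(rRow := Suc k)) m'')"
            by (rule runs_mono) (use Ik m' in \<open>auto simp: less_Suc_eq\<close>)
        qed (use M3 r3 in \<open>auto simp: L_def\<close>)
        then have "runs (For rRow rM feas_row) r3 m2 D (?I (r3 rM))" unfolding D_def .
        then show ?thesis
        proof (rule runs_Seq)
          fix r4 m4 assume I4: "?I (r3 rM) r4 m4" and f4: "frame (For rRow rM feas_row) r3 m2 r4 m4"
          have e4: "env r4 m4" by (rule env_frame[OF e3 f4]) auto
          have acc: "r4 rAcc = (if feas ?t then 1 else 0)" using I4 M3 feas_rows[of ?t] by simp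
          have keep: "r4 x = r x" if "x \<in> {0, rTarget, rIdx}" for x
            using that f4 f2 f1 r3(3) by (auto simp: frame_def)
          have cnt: "r4 rOnes = r1 rOnes" "r4 rTwos = r1 rTwos"
            using f4 f2 r3(3) by (auto simp: frame_def)
          have "m4 aFeas = m aFeas" using f4 m2 by (simp add: frame_def)
          then have "runs finish r4 m4 5 (\<lambda>r' m'. feas_inv (Suc (idx n ?t)) (r' 0) (m' aFeas))"
            by (intro runs_finish[OF e4]) (use keep cnt target t inv acc 1 twos in auto)
          then show "runs finish r4 m4 (D + 5 - D) Q" unfolding Q_def by simp
        qed simp
      qed
      have z: "card (level ?t 2) = 0 \<longleftrightarrow> level ?t 2 = {}" using fin by simp
      show "runs ?c3 r2 m2 (D + (B + 8) - B) Q"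
      proof (cases "level ?t 2 = {}")
        case True
        then have "runs ?c4 (r2(rAcc := r2 rOk, rPtr := r2 rRows)) m2 (D + 5) Q"
          by (intro main) (use ok2 r2 in auto)
        then show ?thesis using True r2 by (simp add: add.commute)
      next
        case False
        then have "runs ?c4 (r2(rX := r2 rX, rPtr := r2 rRows)) m2 (D + 5) Q"
          by (intro main) (use r2 in auto)
        then show ?thesis using False r2 z by (simp add: add.commute)
      qed
    qed simp
    then have "runs ?c2 r1 m1 (D + (B + 8) + 2) Q" by (simp add: ac_simps)
    then show "runs ?c2 r1 m1 (D + (B + (8 * L + 12)) - (8 * L + 2)) Q" by (rule runs_le) simp
  qed simp
  then show ?thesis unfolding Q_def B_def D_def .
qed

end

subsection \<open>The complete program\<close>

text \<open>\<open>rZero\<close> is read without being set because registers start at 0. Cells 3 and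
  4 hold sign and absolute value of the target, and a negative target becomes 0. After the owners
  have been copied, \<open>rPtr\<close> stands at the start of the matrix.\<close>

definition prog :: com where
  "prog = Const rOne 1 ;; Const rTwo 2 ;; Load rN 0 rZero ;; Load rM 0 rOne ;;
     Const rX 3 ;; Load rY 0 rX ;; Const rX 4 ;; Load rTarget 0 rX ;;
     Cond (Equal rY rOne) (Const rTarget 0) skip ;;
     Const rPtr 5 ;; copy_row aOwner ;; Copy rRows rPtr ;; sweep cover_body ;; sweep feas_body"

text \<open>Row-major layout. The bound on the position comes along because \<open>init\<close>
  takes only positions inside the word from the input.\<close>

lemma nth_concat_map:
  assumes "\<And>x. x \<in> set xs \<Longrightarrow> length (f x) = k" "j < length xs" "v < k"
  shows "j * k + v < length (concat (map f xs)) \<and> concat (map f xs) ! (j * k + v) = f (xs ! j) ! v"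
  using assms
proof (induction xs arbitrary: j)
  case (Cons x xs)
  show ?case
  proof (cases j)
    case 0
    then show ?thesis using Cons.prems by (simp add: nth_append)
  next
    case (Suc i)
    have "i * k + v < length (concat (map f xs)) \<and> concat (map f xs) ! (i * k + v) = f (xs ! i) ! v"
      by (rule Cons.IH) (use Cons.prems Suc in auto)
    then show ?thesis using Cons.prems Suc by (simp add: nth_append)
  qed
qed simp

context encoded_instance
begin

section \<open>The input word and the two sweeps on it\<close>

lemma encode_nth:
  "encode I us Ss ! 0 = n" "encode I us Ss ! 1 = M"
  "encode I us Ss ! 3 = (if target I < 0 then 1 else 0)" "encode I us Ss ! 4 = nat \<bar>target I\<bar>"
  "length (encode I us Ss) \<ge> 5"
  by (simp_all add: encode_def nth_append)

lemma encode_owner: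
  assumes "v < n"
  shows "5 + v < length (encode I us Ss)" "encode I us Ss ! (5 + v) = owner I (us ! v)"
  using assms by (simp_all add: encode_def nth_append)

lemma encode_row:
  assumes "j < M" "v < n"
  shows "5 + n + j * n + v < length (encode I us Ss)"
    "encode I us Ss ! (5 + n + j * n + v) = (if us ! v \<in> Ss ! j then 1 else 0)"
proof -
  let ?f = "\<lambda>S. map (\<lambda>u. if u \<in> S then 1 else 0 :: nat) us"
  let ?head = "[n, M, agents I, (if target I < 0 then 1 else 0), nat \<bar>target I\<bar>] @ map (owner I) us"
  have enc: "encode I us Ss = ?head @ concat (map ?f Ss)" by (simp add: encode_def)
  have len: "length ?head = 5 + n" by simp
  have *: "j * n + v < length (concat (map ?f Ss)) \<and> concat (map ?f Ss) ! (j * n + v) = ?f (Ss ! j) ! v"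
    by (rule nth_concat_map) (use assms in auto)
  have eq: "5 + n + j * n + v = length ?head + (j * n + v)" unfolding len by simp
  show "5 + n + j * n + v < length (encode I us Ss)"
    unfolding enc eq length_append using * by simp
  show "encode I us Ss ! (5 + n + j * n + v) = (if us ! v \<in> Ss ! j then 1 else 0)"
    unfolding enc eq nth_append_length_plus using * assms by simp
qed

lemma yes_instance_solution: "yes_instance I \<longleftrightarrow> (\<exists>t. idx n t < 3 ^ n \<and> solution t)"
proof
  assume "yes_instance I"
  then obtain W where W: "W \<subseteq> universe I" "feasible I W W" "int (card W) \<ge> target I"
    unfolding yes_instance_iff[OF inst] by blast
  \<comment> \<open>Digit 2 on \<open>W\<close> and 0 elsewhere: the vector of the pair
    \<open>(W, W)\<close>.\<close>
  define t where "t v = (if us ! v \<in> W then 2 else 0 :: nat)" for v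
  have 2: "level t 2 = W"
    by (rule universe_eqI) (use W(1) level_subset nth_in_level in \<open>auto simp: t_def\<close>)
  have 0: "level t 0 = universe I - W"
    by (rule universe_eqI) (use level_subset nth_in_level nth_in_universe in \<open>auto simp: t_def\<close>)
  have "covered t = W" using W(1) unfolding covered_def 0 by blast
  then have "feas t" using W(2) 2 by (simp add: feas_def)
  moreover have "digits t" "\<forall>v<n. t v \<noteq> 1" by (simp_all add: digits_def t_def)
  moreover have "nat (target I) \<le> card (level t 2)" using W(3) 2 by simp
  ultimately have "solution t" by (simp add: solution_def)
  moreover have "idx n t < 3 ^ n" using \<open>digits t\<close> idx_less by (simp add: digits_def)
  ultimately show "\<exists>t. idx n t < 3 ^ n \<and> solution t" by blast
next
  assume "\<exists>t. idx n t < 3 ^ n \<and> solution t"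
  then obtain t where t: "solution t" by blast
  have "covered t = level t 2"
  proof (rule universe_eqI)
    fix v assume v: "v < n"
    have "t v < 3" "t v \<noteq> 1" using t v by (auto simp: solution_def digits_def)
    then have "t v \<noteq> 0 \<longleftrightarrow> t v = 2" by linarith
    then show "us ! v \<in> covered t \<longleftrightarrow> us ! v \<in> level t 2"
      using nth_in_level[OF v] nth_in_universe[OF v] by (simp add: covered_def)
  qed (use level_subset in \<open>auto simp: covered_def\<close>)
  then have "feasible I (level t 2) (level t 2)" using t by (simp add: solution_def feas_def)
  moreover have "target I \<le> int (card (level t 2))" using t by (simp add: solution_def nat_le_iff)
  ultimately show "yes_instance I" unfolding yes_instance_iff[OF inst] using level_subset by blast
qed

lemma runs_sweep_cover:
  assumes e: "env r m" and zero: "\<And>v. v < n \<Longrightarrow> m aDigits v = 0"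
  shows "runs (sweep cover_body) r m (3 ^ n * (((34 * L + 14) * L + 3) + 8 * L + 7) + 4)
    (\<lambda>r' m'. cover_table (3 ^ n) (m' aCover) \<and>
      (\<forall>v<n. m' aDigits v = 0) \<and> (\<forall>j<3 ^ n. m' aTriple j = 3 * j))"
proof (rule runs_sweep[where Inv = "\<lambda>k a g. cover_table k g" and G = aCover and m = m, OF env_consts[OF e] zero])
  fix k r' m'
  assume *: "r' rIdx = k" "idx n (m' aDigits) = k" "\<forall>v<n. m' aDigits v < 3"
    "\<forall>j. j \<le> k \<or> m aTriple j = 3 * j \<longrightarrow> m' aTriple j = 3 * j"
    "frame (sweep cover_body) r m r' m'" "cover_table k (m' aCover)"
  have "env r' m'" by (rule env_frame[OF e *(5)]) auto
  then have "runs cover_body r' m' ((34 * L + 14) * L + 3)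
    (\<lambda>r' m''. cover_table (Suc (idx n (m' aDigits))) (m'' aCover))"
    by (rule runs_cover_body) (use * in \<open>auto simp: digits_def\<close>)
  then show "runs cover_body r' m' ((34 * L + 14) * L + 3) (\<lambda>r'' m''. cover_table (Suc k) (m'' aCover))"
    unfolding *(2) .
qed (auto simp: cover_table_def)

lemma runs_sweep_feas:
  assumes e: "env r m" and zero: "\<And>v. v < n \<Longrightarrow> m aDigits v = 0"
    and "r rTarget = nat (target I)" "r 0 = 0" "cover_table (3 ^ n) (m aCover)"
    and tr: "\<And>j. j < 3 ^ n \<Longrightarrow> m aTriple j = 3 * j"
  shows "runs (sweep feas_body) r m
    (3 ^ n * ((((20 * L + 9) * L + (23 * L + 10) + 2) * L + ((20 * L + 9) * L + (8 * L + 12))) + 8 * L + 7) + 4)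
    (\<lambda>r' m'. r' 0 = (if yes_instance I then 1 else 0))"
proof -
  define B where "B = ((20 * L + 9) * L + (23 * L + 10) + 2) * L + ((20 * L + 9) * L + (8 * L + 12))"
  have "runs (sweep feas_body) r m (3 ^ n * (B + 8 * L + 7) + 4) (\<lambda>r' m'. feas_inv (3 ^ n) (r' 0) (m' aFeas) \<and>
      (\<forall>v<n. m' aDigits v = 0) \<and> (\<forall>j<3 ^ n. m' aTriple j = 3 * j))"
  proof (rule runs_sweep[where Inv = feas_inv and G = aFeas and m = m, OF env_consts[OF e] zero])
    fix k r' m'
    assume *: "r' rIdx = k" "idx n (m' aDigits) = k" "\<forall>v<n. m' aDigits v < 3"
      "\<forall>j. j \<le> k \<or> m aTriple j = 3 * j \<longrightarrow> m' aTriple j = 3 * j"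
      "frame (sweep feas_body) r m r' m'" "feas_inv k (r' 0) (m' aFeas)"
    have "env r' m'" by (rule env_frame[OF e *(5)]) auto
    moreover have "r' rTarget = r rTarget" "m' aCover = m aCover" using *(5) by (auto simp: frame_def)
    ultimately have "runs feas_body r' m' B
      (\<lambda>r' m''. feas_inv (Suc (idx n (m' aDigits))) (r' 0) (m'' aFeas))"
      unfolding B_def by (intro runs_feas_body) (use * assms in \<open>auto simp: digits_def\<close>)
    then show "runs feas_body r' m' B (\<lambda>r'' m''. feas_inv (Suc k) (r'' 0) (m'' aFeas))"
      unfolding *(2) .
  qed (use assms in \<open>auto simp: feas_inv_def feas_table_def\<close>)
  then show ?thesis unfolding B_def
    by (rule runs_mono) (auto simp: feas_inv_def yes_instance_solution)
qed

lemma runs_prog: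
  "runs prog (fst (init (encode I us Ss))) (snd (init (encode I us Ss))) (300 * 3 ^ n * L ^ 3)
    (\<lambda>r' m'. r' 0 = (if yes_instance I then 1 else 0))"
proof -
  let ?w = "encode I us Ss"
  define r where "r = fst (init ?w)"
  define m where "m = snd (init ?w)"
  define Q where "Q = (\<lambda>(r' :: regs) (m' :: arrs). r' 0 = (if yes_instance I then 1 else 0 :: nat))"
  have r: "r x = 0" for x by (simp add: r_def init_def)
  have m0: "m 0 k = ?w ! k" if "k < length ?w" for k using that by (simp add: m_def init_def)
  have ma: "a \<noteq> 0 \<Longrightarrow> m a k = 0" for a k by (simp add: m_def init_def)
  have hdr: "m 0 0 = n" "m 0 1 = M" "m 0 3 = (if target I < 0 then 1 else 0)" "m 0 4 = nat \<bar>target I\<bar>"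
  proof -
    have "m 0 k = ?w ! k" if "k < 5" for k using m0[of k] that encode_nth(5) by linarith
    then show "m 0 0 = n" "m 0 1 = M" "m 0 3 = (if target I < 0 then 1 else 0)" "m 0 4 = nat \<bar>target I\<bar>"
      using encode_nth by simp_all
  qed
  define T1 where "T1 = 3 ^ n * (((34 * L + 14) * L + 3) + 8 * L + 7) + 4"
  define T2 where "T2 = 3 ^ n * ((((20 * L + 9) * L + (23 * L + 10) + 2) * L + ((20 * L + 9) * L + (8 * L + 12))) + 8 * L + 7) + 4"
  let ?c1 = "Copy rRows rPtr ;; sweep cover_body ;; sweep feas_body"
  have rest: "runs (copy_row aOwner ;; ?c1) r1 m (5 * L + (1 + (T1 + T2))) Q"
    if r1: "r1 rOne = 1" "r1 rTwo = 2" "r1 rZero = 0" "r1 rN = n" "r1 rM = M" "r1 rPtr = 5" "r1 0 = 0"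
      "r1 rTarget = nat (target I)" for r1
  proof -
    have ok1: "consts_ok n L r1" using r1 by (simp add: consts_ok_def L_def)
    show ?thesis
    proof (rule runs_Seq[OF runs_copy_row[OF ok1]])
      fix r2 m2 assume 2: "r2 rPtr = r1 rPtr + n \<and> (\<forall>v<n. m2 aOwner v = m 0 (r1 rPtr + v))"
        and f2: "frame (copy_row aOwner) r1 m r2 m2"
      let ?r2 = "r2(rRows := r2 rPtr)"
      have own: "m2 aOwner v = owner I (us ! v)" if "v < n" for v
        using 2 r1 encode_owner[OF that] that m0 by simp
      have mat: "m2 0 (5 + n + j * n + v) = (if us ! v \<in> Ss ! j then 1 else 0)" if "j < M" "v < n" for j v
      proof -
        have "m2 0 = m 0" using f2 by (simp add: frame_def)
        then show ?thesis using m0[OF encode_row(1)[OF that]] encode_row(2)[OF that] by simp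
      qed
      have "consts_ok n L ?r2" using ok1 f2 by (simp add: consts_ok_def frame_def)
      moreover have "?r2 rM = M" "?r2 rRows = 5 + n" using f2 r1 2 by (simp_all add: frame_def)
      ultimately have e2: "env ?r2 m2" unfolding env_def using own mat by blast
      have z2: "m2 aDigits v = 0" for v using f2 ma by (simp add: frame_def)
      have "runs (sweep cover_body ;; sweep feas_body) ?r2 m2 (T1 + T2) Q"
      proof (rule runs_Seq[OF runs_sweep_cover[OF e2 z2, folded T1_def]])
        fix r3 m3 assume 3: "cover_table (3 ^ n) (m3 aCover) \<and> (\<forall>v<n. m3 aDigits v = 0) \<and>
            (\<forall>j<3 ^ n. m3 aTriple j = 3 * j)"
          and f3: "frame (sweep cover_body) ?r2 m2 r3 m3"
        have e3: "env r3 m3" by (rule env_frame[OF e2 f3]) auto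
        have "r3 0 = 0" "r3 rTarget = nat (target I)" using f3 f2 r1 by (auto simp: frame_def)
        then have "runs (sweep feas_body) r3 m3 T2 Q"
          unfolding T2_def Q_def by (intro runs_sweep_feas[OF e3]) (use 3 in auto)
        then show "runs (sweep feas_body) r3 m3 (T1 + T2 - T1) Q" by simp
      qed simp
      then show "runs ?c1 r2 m2 (5 * L + (1 + (T1 + T2)) - 5 * L) Q" by simp
    qed simp_all
  qed
  \<comment> \<open>11 units precede \<open>copy_row\<close>; the conditional counts twice, for its
    test and for the branch taken.\<close>
  have prog: "runs prog r m (11 + (5 * L + (1 + (T1 + T2)))) Q"
  proof -
    let ?r = "r(rOne := 1, rTwo := 2, rN := n, rM := M, rX := 3, rY := (if target I < 0 then 1 else 0), rX := 4,
       rTarget := nat \<bar>target I\<bar>)"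
    have "runs (copy_row aOwner ;; ?c1)
      ((if target I < 0 then ?r(rTarget := 0) else ?r(rX := ?r rX))(rPtr := 5)) m (5 * L + (1 + (T1 + T2))) Q"
      by (rule rest) (simp_all add: r)
    then show ?thesis
      unfolding prog_def
      by (cases "target I < 0") (simp_all add: r hdr hdr(2)[unfolded One_nat_def] ac_simps)
  qed
  have "11 + (5 * L + (1 + (T1 + T2))) \<le> 300 * 3 ^ n * L ^ 3"
  proof -
    have L1: "1 \<le> L" by (simp add: L_def)
    have p: "L \<le> L ^ 3" "L ^ 2 \<le> L ^ 3" "1 \<le> L ^ 3"
      using L1 power_increasing[of 1 3 L] power_increasing[of 2 3 L] by simp_all
    have "T1 + T2 = 3 ^ n * (20 * L ^ 3 + 86 * L ^ 2 + 59 * L + 29) + 8"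
      by (simp add: T1_def T2_def algebra_simps power2_eq_square power3_eq_cube)
    \<comment> \<open>194 is 20 + 86 + 59 + 29, as every power of \<open>L\<close> in the sum is at
      most \<open>L ^ 3\<close>. The gap up to 300 absorbs the cost outside the sweeps.\<close>
    also have "\<dots> \<le> 3 ^ n * (194 * L ^ 3) + 8"
      using p by (intro add_right_mono mult_left_mono) linarith+
    finally have 1: "T1 + T2 \<le> 194 * (3 ^ n * L ^ 3) + 8" by simp
    have 2: "L ^ 3 \<le> 3 ^ n * L ^ 3" by simp
    have "300 * 3 ^ n * L ^ 3 = 300 * (3 ^ n * L ^ 3)" by simp
    then show ?thesis using 1 2 p by linarith
  qed
  with prog have "runs prog r m (300 * 3 ^ n * L ^ 3) Q" by (rule runs_le)
  then show ?thesis unfolding r_def m_def Q_def .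
qed

end

theorem theorem15:
  fixes d :: nat
  shows "\<exists>(P :: com) (C :: nat) (c :: nat). \<forall>(I :: nat rp_instance) us Ss.
     rp_sp_instance d I \<and> enumerates us (universe I) \<and> enumerates Ss (sets I) \<longrightarrow>
     answers_within P (encode I us Ss) (yes_instance I)
       (C * 3 ^ card (universe I) * (card (universe I) + card (sets I) + 1) ^ c)"
proof (rule exI[of _ prog], rule exI[of _ 300], rule exI[of _ 3], intro allI impI)
  fix I :: "nat rp_instance" and us Ss
  assume "rp_sp_instance d I \<and> enumerates us (universe I) \<and> enumerates Ss (sets I)"
  then interpret encoded_instance I d us Ss by unfold_locales auto
  show "answers_within prog (encode I us Ss) (yes_instance I)
     (300 * 3 ^ card (universe I) * (card (universe I) + card (sets I) + 1) ^ 3)"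
    using runs_prog unfolding runs_def answers_within_def card_universe card_sets L_def
    by (metis fst_conv prod.collapse)
qed

end
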